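(* Let $G$ be a planar graph with maximum degree $\Delta\geq 27$ and let $H$ be a subgraph of $G$ that is a distance-3 matching. Then any total-$(\Delta+1)$-coloring of $H$ can be extended to a total-$(\Delta+1)$-coloring of $G$.
   Context: All graphs are simple. A total-$k$-coloring of a graph is an assignment of colors from $\{1,\dots,k\}$ to its vertices and edges such that adjacent vertices receive different colors, edges sharing an endpoint receive different colors, and no edge receives the same color as either of its endpoints. A subgraph $H$ of $G$ is a matching if it consists of vertex-disjoint copies of $K_2$; it is a distance-3 matching if moreover any two vertices in distinct components of $H$ are at distance at least $3$ in $G$. Extending a total coloring $\varphi$ of $H$ to $G$ means finding a total-$k$-coloring of $G$ agreeing with $\varphi$ on all vertices and edges of $H$. *)

theory Defs
  imports "HOL-Analysis.Analysis"
begin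

definition simple_graph :: "'a set \<Rightarrow> 'a set set \<Rightarrow> bool" where
  "simple_graph V E \<longleftrightarrow> finite V \<and> (\<forall>e\<in>E. e \<subseteq> V \<and> card e = 2)"

definition degree :: "'a set set \<Rightarrow> 'a \<Rightarrow> nat" where
  "degree E v = card {e \<in> E. v \<in> e}"

definition max_degree :: "'a set \<Rightarrow> 'a set set \<Rightarrow> nat" where
  "max_degree V E = Max (insert 0 (degree E ` V))"

definition planar :: "'a set \<Rightarrow> 'a set set \<Rightarrow> bool" where
  "planar V E \<longleftrightarrow>
    (\<exists>(pos :: 'a \<Rightarrow> real^2) (\<gamma> :: 'a set \<Rightarrow> real \<Rightarrow> real^2).
        inj_on pos V \<and>
        (\<forall>e\<in>E. arc (\<gamma> e) \<and> {pathstart (\<gamma> e), pathfinish (\<gamma> e)} = pos ` e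
               \<and> path_image (\<gamma> e) \<inter> pos ` V = pos ` e) \<and>
        (\<forall>e\<in>E. \<forall>e'\<in>E. e \<noteq> e' \<longrightarrow>
               path_image (\<gamma> e) \<inter> path_image (\<gamma> e') \<subseteq> pos ` (e \<inter> e')))"

definition total_coloring ::
  "'a set \<Rightarrow> 'a set set \<Rightarrow> nat \<Rightarrow> ('a \<Rightarrow> nat) \<Rightarrow> ('a set \<Rightarrow> nat) \<Rightarrow> bool" where
  "total_coloring V E k cv ce \<longleftrightarrow>
     (\<forall>v\<in>V. cv v \<in> {1..k}) \<and> (\<forall>e\<in>E. ce e \<in> {1..k}) \<and>
     (\<forall>u\<in>V. \<forall>v\<in>V. {u, v} \<in> E \<longrightarrow> cv u \<noteq> cv v) \<and>
     (\<forall>e\<in>E. \<forall>e'\<in>E. e \<noteq> e' \<and> e \<inter> e' \<noteq> {} \<longrightarrow> ce e \<noteq> ce e') \<and>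
     (\<forall>e\<in>E. \<forall>v\<in>e. ce e \<noteq> cv v)"

definition subgraph :: "'a set \<Rightarrow> 'a set set \<Rightarrow> 'a set \<Rightarrow> 'a set set \<Rightarrow> bool" where
  "subgraph VH EH V E \<longleftrightarrow> VH \<subseteq> V \<and> EH \<subseteq> E \<and> (\<forall>e\<in>EH. e \<subseteq> VH)"

definition is_matching :: "'a set \<Rightarrow> 'a set set \<Rightarrow> bool" where
  "is_matching VH EH \<longleftrightarrow> (\<forall>v\<in>VH. degree EH v = 1)"

text \<open>Distance-3 matching in G: vertices in distinct components (edges) of H are at
  distance at least 3 in G, i.e. distinct, non-adjacent and without common neighbour.\<close>
definition distance3_matching ::
  "'a set \<Rightarrow> 'a set set \<Rightarrow> 'a set \<Rightarrow> 'a set set \<Rightarrow> bool" where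
  "distance3_matching V E VH EH \<longleftrightarrow> is_matching VH EH \<and>
     (\<forall>e1\<in>EH. \<forall>e2\<in>EH. e1 \<noteq> e2 \<longrightarrow> (\<forall>u\<in>e1. \<forall>v\<in>e2.
        u \<noteq> v \<and> {u, v} \<notin> E \<and> \<not> (\<exists>w\<in>V. {u, w} \<in> E \<and> {w, v} \<in> E)))"

end

(* Write D for the maximum degree. A minimal counterexample is restricted by recolouring: an edge at
   an uncoloured vertex of degree at most 5, or an uncoloured edge at a precoloured vertex, has large
   degree sum, and there is no alternating subgraph in the sense of Borodin, Kostochka and Woodall,
   since such a subgraph could be coloured by Galvin's list colouring theorem for bipartite graphs.
   So every small vertex has masters of degree close to D. Discharging d(v) - 6 along the masters,
   and from one outside neighbour to each edge of H of small degree sum, makes all charges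
   nonnegative, against |E| < 3|V|. Here distance 3 ensures that no vertex pays for two edges of H.
   The edge bound is obtained without faces. A cycle of length l with n vertices inside has at most
   3n + l - 3 edges inside: a path through the inside splits it by the theta-curve theorem, and if
   there is no such path, the vertices of the cycle lie in distinct components of the inside graph.
   For a cycle with the most edges inside, there is no connecting path on the outside either. *)

theory Submission
  imports Defs "HOL-Complex_Analysis.Winding_Numbers"
begin

section \<open>List edge colouring of bipartite graphs\<close>

text \<open>Only uncoloured vertices of degree at most 5 can be erased and coloured again at the
  end: they see at most 5 vertices, 5 edges and 2 colours forbidden on account of H. Precoloured
  vertices cannot, so an edge between H and the rest satisfies a degree-sum bound weaker by one, and
  an edge of H satisfies none; hence the separate discharging rule for H. Deleting an edge between H
  and the rest also loses the information that its ends must differ, which the sets \<open>B\<close>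
  preserve. These have at most 2 elements by distance 3: no vertex outside H has neighbours in two
  edges of H. An edge of H that is a whole component of G has charge -10 and no neighbour to pay for
  it; such edges are removed before charges are compared. Masters are chosen separately for each
  level i from 2 to 5, so that a small vertex of degree d has one at each of 6 - d levels, which is
  its deficit. Planarity is used only through |E'| <= 3|V'| - 3 for nonempty subgraphs.\<close>

definition proper_edge_coloring :: "('u \<times> 'w) set \<Rightarrow> ('u \<times> 'w \<Rightarrow> 'c) \<Rightarrow> bool" where
  "proper_edge_coloring F c \<longleftrightarrow>
     (\<forall>e\<in>F. \<forall>e'\<in>F. e \<noteq> e' \<and> (fst e = fst e' \<or> snd e = snd e') \<longrightarrow> c e \<noteq> c e')"

section \<open>Koenig's edge colouring theorem by alternating chains\<close>

lemma missing_color: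
  fixes c :: "'e \<Rightarrow> nat"
  assumes "finite A" "card A < i"
  obtains \<alpha> where "\<alpha> < i" "\<alpha> \<notin> c ` A"
proof -
  have "card (c ` A) < card {..<i}"
    using card_image_le[OF assms(1), of c] assms(2) by simp
  then have "\<not> {..<i} \<subseteq> c ` A"
    using assms(1) by (meson card_mono finite_imageI not_le)
  then show thesis using that by auto
qed

text \<open>Only the second-class vertices of the alternating chain from \<open>w0\<close> are
  recorded, since the recolouring treats all edges at such a vertex at once. Each step crosses a
  first-class vertex, in through an \<alpha>-edge and out through a \<beta>-edge.\<close>

inductive_set kempe_reach ::
  "('u \<times> 'w) set \<Rightarrow> ('u \<times> 'w \<Rightarrow> nat) \<Rightarrow> nat \<Rightarrow> nat \<Rightarrow> 'w \<Rightarrow> 'w set"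
  for F c \<alpha> \<beta> w0 where
  start: "w0 \<in> kempe_reach F c \<alpha> \<beta> w0"
| step: "w \<in> kempe_reach F c \<alpha> \<beta> w0 \<Longrightarrow> (u, w) \<in> F \<Longrightarrow> c (u, w) = \<alpha> \<Longrightarrow>
     (u, w') \<in> F \<Longrightarrow> c (u, w') = \<beta> \<Longrightarrow> w' \<in> kempe_reach F c \<alpha> \<beta> w0"

text \<open>The chain from \<open>w0\<close> enters first-class vertices through \<alpha>-edges
  only, so it cannot pass \<open>u0\<close>, where \<alpha> is missing. Swapping the colours along
  it frees \<alpha> at \<open>w0\<close> and keeps it free at \<open>u0\<close>.\<close>

lemma kempe_swap:
  fixes F :: "('u \<times> 'w) set" and c :: "'u \<times> 'w \<Rightarrow> nat"
  assumes pr: "proper_edge_coloring F c" and rng: "c ` F \<subseteq> {..<i}"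
    and a: "\<alpha> < i" "\<And>w. (u0, w) \<in> F \<Longrightarrow> c (u0, w) \<noteq> \<alpha>"
    and b: "\<beta> < i" "\<And>u. (u, w0) \<in> F \<Longrightarrow> c (u, w0) \<noteq> \<beta>"
    and ab: "\<alpha> \<noteq> \<beta>"
  obtains c' where "proper_edge_coloring F c'" "c' ` F \<subseteq> {..<i}"
    "\<And>w. (u0, w) \<in> F \<Longrightarrow> c' (u0, w) \<noteq> \<alpha>"
    "\<And>u. (u, w0) \<in> F \<Longrightarrow> c' (u, w0) \<noteq> \<alpha>"
proof -
  define R where "R = kempe_reach F c \<alpha> \<beta> w0"
  define sw where "sw x = (if x = \<alpha> then \<beta> else if x = \<beta> then \<alpha> else x)" for x
  define c' where "c' e = (if snd e \<in> R then sw (c e) else c e)" for e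
  have pU: "w = w'" if "(u, w) \<in> F" "(u, w') \<in> F" "c (u, w) = c (u, w')" for u w w'
    using pr that unfolding proper_edge_coloring_def by force
  have pW: "u = u'" if "(u, w) \<in> F" "(u', w) \<in> F" "c (u, w) = c (u', w)" for u u' w
    using pr that unfolding proper_edge_coloring_def by force
  have fwd: "w' \<in> R" if "w \<in> R" "(u, w) \<in> F" "c (u, w) = \<alpha>" "(u, w') \<in> F" "c (u, w') = \<beta>" for u w w'
    using that kempe_reach.step unfolding R_def by metis
  \<comment> \<open>A member of the chain other than \<open>w0\<close> was entered by a
    \<beta>-edge, its only one by properness; \<open>w0\<close> has none. Together with
    \<open>fwd\<close>, an \<alpha>-edge and a \<beta>-edge at the same first-class vertex are both
    swapped or both kept.\<close>
  have bwd: "\<exists>w\<in>R. (u, w) \<in> F \<and> c (u, w) = \<alpha>" if "w' \<in> R" "(u, w') \<in> F" "c (u, w') = \<beta>" for u w'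
  proof -
    have "w' \<in> kempe_reach F c \<alpha> \<beta> w0" using that(1) unfolding R_def .
    then show ?thesis
    proof cases
      case start
      then show ?thesis using b that by auto
    next
      case (step w u')
      then have "u' = u" using pW[of u' w' u] that by simp
      then show ?thesis using step by (auto simp: R_def)
    qed
  qed
  have sw_inj: "sw x = sw y \<longleftrightarrow> x = y" for x y
    using ab by (auto simp: sw_def)
  have "proper_edge_coloring F c'"
    unfolding proper_edge_coloring_def
  proof (intro ballI impI)
    fix e e' assume e: "e \<in> F" "e' \<in> F" "e \<noteq> e' \<and> (fst e = fst e' \<or> snd e = snd e')"
    obtain u w u' w' where ee: "e = (u, w)" "e' = (u', w')" by (cases e; cases e')
    have ne: "c e \<noteq> c e'" using pr e unfolding proper_edge_coloring_def by blast
    show "c' e \<noteq> c' e'"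
    proof (cases "(w \<in> R) = (w' \<in> R)")
      case True
      then show ?thesis using ne sw_inj by (auto simp: c'_def ee)
    next
      case False
      then have uu: "u = u'" using e ee by auto
      have key: False if k: "x \<in> R" "y \<notin> R" "(u, x) \<in> F" "(u, y) \<in> F" "sw (c (u, x)) = c (u, y)" "c (u, x) \<noteq> c (u, y)" for x y
      proof -
        consider "c (u, x) = \<alpha>" "c (u, y) = \<beta>" | "c (u, x) = \<beta>" "c (u, y) = \<alpha>"
          using k(5,6) unfolding sw_def by metis
        then show False
        proof cases
          case 1 then show ?thesis using fwd[of x u y] k by blast
        next
          case 2
          then obtain z where z: "z \<in> R" "(u, z) \<in> F" "c (u, z) = \<alpha>" using bwd[of x u] k by blast
          then have "z = y" using pU[of u z y] k 2 by simp
          then show ?thesis using z k by simp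
        qed
      qed
      from False consider "w \<in> R" "w' \<notin> R" | "w \<notin> R" "w' \<in> R" by blast
      then show ?thesis
      proof cases
        case 1
        then show ?thesis using key[of w w'] e(1,2) ne unfolding c'_def ee uu by auto
      next
        case 2
        then show ?thesis using key[of w' w] e(1,2) ne unfolding c'_def ee uu by auto
      qed
    qed
  qed
  moreover have "c' ` F \<subseteq> {..<i}"
    using rng a b by (auto simp: c'_def sw_def)
  moreover have "c' (u0, w) \<noteq> \<alpha>" if "(u0, w) \<in> F" for w
    using a(2) that bwd[of w u0] ab by (auto simp: c'_def sw_def)
  moreover have "c' (u, w0) \<noteq> \<alpha>" if "(u, w0) \<in> F" for u
  proof -
    have "w0 \<in> R" by (simp add: R_def kempe_reach.start)
    then show ?thesis using b(2) that ab by (auto simp: c'_def sw_def)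
  qed
  ultimately show thesis using that by blast
qed

theorem bipartite_edge_coloring:
  fixes F :: "('u \<times> 'w) set"
  assumes "finite F" "\<And>u. card {e \<in> F. fst e = u} \<le> i" "\<And>w. card {e \<in> F. snd e = w} \<le> i"
  shows "\<exists>c. proper_edge_coloring F c \<and> c ` F \<subseteq> {..<i}"
  using assms
proof (induction F rule: finite_induct)
  case empty
  then show ?case by (simp add: proper_edge_coloring_def)
next
  case (insert x F)
  obtain u0 w0 where x: "x = (u0, w0)" by (cases x)
  have *: "{e \<in> insert x F. fst e = u0} = insert x {e \<in> F. fst e = u0}"
    "{e \<in> insert x F. snd e = w0} = insert x {e \<in> F. snd e = w0}" by (auto simp: x)
  have "card {e \<in> insert x F. fst e = u} \<ge> card {e \<in> F. fst e = u}" for u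
    using insert.hyps by (intro card_mono) auto
  moreover have "card {e \<in> insert x F. snd e = u} \<ge> card {e \<in> F. snd e = u}" for u
    using insert.hyps by (intro card_mono) auto
  ultimately obtain c where c: "proper_edge_coloring F c" "c ` F \<subseteq> {..<i}"
    using insert.IH insert.prems by (meson le_trans)
  have d: "card {e \<in> F. fst e = u0} < i" "card {e \<in> F. snd e = w0} < i"
    using insert.prems(1)[of u0] insert.prems(2)[of w0] insert.hyps unfolding * by auto
  obtain \<alpha> where \<alpha>: "\<alpha> < i" "\<alpha> \<notin> c ` {e \<in> F. fst e = u0}"
    by (rule missing_color[OF _ d(1), of c]) (use insert.hyps in auto)
  obtain \<beta> where \<beta>: "\<beta> < i" "\<beta> \<notin> c ` {e \<in> F. snd e = w0}"
    by (rule missing_color[OF _ d(2), of c]) (use insert.hyps in auto)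
  obtain c' where c': "proper_edge_coloring F c'" "c' ` F \<subseteq> {..<i}"
    "\<And>w. (u0, w) \<in> F \<Longrightarrow> c' (u0, w) \<noteq> \<alpha>" "\<And>u. (u, w0) \<in> F \<Longrightarrow> c' (u, w0) \<noteq> \<alpha>"
  proof (cases "\<alpha> = \<beta>")
    case True
    then show ?thesis using \<alpha> \<beta> c that[of c] by force
  next
    case False
    show ?thesis
      by (rule kempe_swap[OF c \<alpha>(1) _ \<beta>(1) _ False, of u0 w0]) (use \<alpha> \<beta> that in force)+
  qed
  have "proper_edge_coloring (insert x F) (c'(x := \<alpha>))"
    unfolding proper_edge_coloring_def
  proof (intro ballI impI)
    have new: "c' e \<noteq> \<alpha>" if "e \<in> F" "fst e = u0 \<or> snd e = w0" for e
      using that c'(3)[of "snd e"] c'(4)[of "fst e"] by (cases e) auto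
    have old: "c' e \<noteq> c' e'" if "e \<in> F" "e' \<in> F" "e \<noteq> e'" "fst e = fst e' \<or> snd e = snd e'" for e e'
      using c'(1) that unfolding proper_edge_coloring_def by blast
    fix e e' assume "e \<in> insert x F" "e' \<in> insert x F" "e \<noteq> e' \<and> (fst e = fst e' \<or> snd e = snd e')"
    then show "(c'(x := \<alpha>)) e \<noteq> (c'(x := \<alpha>)) e'"
      using new[of e] new[of e'] old[of e e'] x by (cases "e = x"; cases "e' = x") auto
  qed
  moreover have "(c'(x := \<alpha>)) ` insert x F \<subseteq> {..<i}"
    using c'(2) \<alpha> by auto
  ultimately show ?case by blast
qed

section \<open>Galvin's theorem through stable matchings\<close>

text \<open>Gale and Shapley in recursive form, small values of \<open>f\<close> and
  \<open>g\<close> being preferred. If the favourite edges of the second class do not collide, they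
  form the matching; otherwise two of them share a first-class vertex and the one that is worse
  there can be deleted.\<close>

lemma stable_matching:
  fixes F :: "('u \<times> 'w) set" and f g :: "'u \<times> 'w \<Rightarrow> nat"
  assumes "finite F"
    and f: "\<And>e e'. e \<in> F \<Longrightarrow> e' \<in> F \<Longrightarrow> snd e = snd e' \<Longrightarrow> f e = f e' \<Longrightarrow> e = e'"
    and g: "\<And>e e'. e \<in> F \<Longrightarrow> e' \<in> F \<Longrightarrow> fst e = fst e' \<Longrightarrow> g e = g e' \<Longrightarrow> e = e'"
  shows "\<exists>M\<subseteq>F. inj_on fst M \<and> inj_on snd M \<and>
    (\<forall>e\<in>F - M. \<exists>e'\<in>M. snd e' = snd e \<and> f e' < f e \<or> fst e' = fst e \<and> g e' < g e)"
  using assms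
proof (induction "card F" arbitrary: F rule: less_induct)
  case less
  define B where "B = {e \<in> F. \<forall>e'\<in>F. snd e' = snd e \<longrightarrow> f e \<le> f e'}"
  have BF: "B \<subseteq> F" by (auto simp: B_def)
  have injB: "inj_on snd B"
    unfolding inj_on_def B_def using less.prems(2) by (simp add: order_antisym)
  have dom: "\<exists>e'\<in>B. snd e' = snd e \<and> f e' < f e" if "e \<in> F - B" for e
  proof -
    define e' where "e' = arg_min f (\<lambda>x. x \<in> F \<and> snd x = snd e)"
    have e': "e' \<in> F \<and> snd e' = snd e" "\<And>y. y \<in> F \<and> snd y = snd e \<Longrightarrow> f e' \<le> f y"
      using arg_min_nat_lemma[of "\<lambda>x. x \<in> F \<and> snd x = snd e" e f] that unfolding e'_def by auto
    then have "e' \<in> B" by (auto simp: B_def)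
    moreover have "f e' < f e"
      using that e' e'(2)[of e] less.prems(2)[of e e'] \<open>e' \<in> B\<close> by (metis DiffD1 DiffD2 le_neq_implies_less)
    ultimately show ?thesis using e' by auto
  qed
  show ?case
  proof (cases "inj_on fst B")
    case True
    show ?thesis
      using dom by (intro exI[of _ B] conjI BF True injB) blast
  next
    case False
    then obtain x y where xy: "x \<in> B" "y \<in> B" "fst x = fst y" "x \<noteq> y"
      unfolding inj_on_def by blast
    then have "g x \<noteq> g y" using less.prems(3) BF by blast
    then obtain e1 e2 where e: "e1 \<in> B" "e2 \<in> B" "fst e1 = fst e2" "g e1 < g e2"
      using xy by (metis nat_neq_iff)
    have "card (F - {e2}) < card F"
      using e BF less.prems(1) by (meson card_Diff1_less subsetD)
    then obtain M where M: "M \<subseteq> F - {e2}" "inj_on fst M" "inj_on snd M"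
      "\<forall>e\<in>F - {e2} - M. \<exists>e'\<in>M. snd e' = snd e \<and> f e' < f e \<or> fst e' = fst e \<and> g e' < g e"
      using less.hyps[of "F - {e2}", OF _ finite_Diff[OF less.prems(1)]] less.prems(2,3) by auto
    \<comment> \<open>The deleted edge is still dominated: by \<open>e1\<close> itself or, since
      \<open>e1\<close> is best at its second end, by an edge that beats \<open>e1\<close> at the
      end shared with \<open>e2\<close>.\<close>
    have "\<exists>e'\<in>M. fst e' = fst e2 \<and> g e' < g e2"
    proof (cases "e1 \<in> M")
      case True
      then show ?thesis using e by auto
    next
      case False
      then have "e1 \<in> F - {e2} - M" using e BF by auto
      then obtain e' where e': "e' \<in> M" "snd e' = snd e1 \<and> f e' < f e1 \<or> fst e' = fst e1 \<and> g e' < g e1"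
        using M(4) by blast
      moreover have "\<not> (snd e' = snd e1 \<and> f e' < f e1)"
        using e(1) e' M(1) unfolding B_def by fastforce
      ultimately show ?thesis using e by (metis less_trans)
    qed
    then have "\<forall>e\<in>F - M. \<exists>e'\<in>M. snd e' = snd e \<and> f e' < f e \<or> fst e' = fst e \<and> g e' < g e"
      using M(4) by (metis DiffD1 DiffD2 DiffI singletonD)
    moreover have "M \<subseteq> F" using M(1) by blast
    ultimately show ?thesis using M(2,3) by (intro exI[of _ M] conjI)
  qed
qed

text \<open>One colour is given to a stable matching among the edges that have it in their lists.
  Every other such edge loses this colour but also a neighbour that it yields to, so the strict
  inequality survives.\<close>

lemma galvin_kernel:
  fixes F :: "('u \<times> 'w) set" and f g :: "'u \<times> 'w \<Rightarrow> nat" and L :: "'u \<times> 'w \<Rightarrow> 'c set"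
  assumes "finite F"
    and f: "\<And>e e'. e \<in> F \<Longrightarrow> e' \<in> F \<Longrightarrow> snd e = snd e' \<Longrightarrow> f e = f e' \<Longrightarrow> e = e'"
    and g: "\<And>e e'. e \<in> F \<Longrightarrow> e' \<in> F \<Longrightarrow> fst e = fst e' \<Longrightarrow> g e = g e' \<Longrightarrow> e = e'"
    and L: "\<And>e. e \<in> F \<Longrightarrow> finite (L e) \<and>
      card {e' \<in> F. snd e' = snd e \<and> f e' < f e} + card {e' \<in> F. fst e' = fst e \<and> g e' < g e} < card (L e)"
  shows "\<exists>c. proper_edge_coloring F c \<and> (\<forall>e\<in>F. c e \<in> L e)"
  using assms
proof (induction "card F" arbitrary: F L rule: less_induct)
  case less
  show ?case
  proof (cases "F = {}")
    case True
    then show ?thesis by (simp add: proper_edge_coloring_def)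
  next
    case False
    then obtain e0 where e0: "e0 \<in> F" by blast
    then have "L e0 \<noteq> {}" using less.prems(4)[of e0] by auto
    then obtain \<alpha> where \<alpha>: "\<alpha> \<in> L e0" by blast
    define F\<alpha> where "F\<alpha> = {e \<in> F. \<alpha> \<in> L e}"
    have "\<exists>M\<subseteq>F\<alpha>. inj_on fst M \<and> inj_on snd M \<and>
    (\<forall>e\<in>F\<alpha> - M. \<exists>e'\<in>M. snd e' = snd e \<and> f e' < f e \<or> fst e' = fst e \<and> g e' < g e)"
      using less.prems by (intro stable_matching) (auto simp: F\<alpha>_def)
    then obtain M where M: "M \<subseteq> F\<alpha>" "inj_on fst M" "inj_on snd M"
      "\<And>e. e \<in> F\<alpha> - M \<Longrightarrow> \<exists>e'\<in>M. snd e' = snd e \<and> f e' < f e \<or> fst e' = fst e \<and> g e' < g e"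
      by blast
    have "e0 \<in> F\<alpha>" using e0 \<alpha> by (auto simp: F\<alpha>_def)
    then have "M \<noteq> {}" using M(4) by blast
    moreover have MF: "M \<subseteq> F" using M(1) by (auto simp: F\<alpha>_def)
    ultimately have lt: "card (F - M) < card F"
      using less.prems(1) by (metis Diff_subset Int_absorb1 Diff_disjoint order_le_neq_trans psubset_card_mono psubsetI inf_commute)
    have "\<exists>c. proper_edge_coloring (F - M) c \<and> (\<forall>e\<in>F - M. c e \<in> L e - {\<alpha>})"
    proof (rule less.hyps[OF lt])
      fix e assume e: "e \<in> F - M"
      let ?A = "\<lambda>F. {e' \<in> F. snd e' = snd e \<and> f e' < f e}"
      let ?B = "\<lambda>F. {e' \<in> F. fst e' = fst e \<and> g e' < g e}"
      have fin: "finite (?A F)" "finite (?B F)" using less.prems(1) by auto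
      have le: "card (?A (F - M)) \<le> card (?A F)" "card (?B (F - M)) \<le> card (?B F)"
        using fin by (auto intro!: card_mono)
      have Le: "finite (L e)" "card (?A F) + card (?B F) < card (L e)"
        using less.prems(4)[of e] e by auto
      have "card (?A (F - M)) + card (?B (F - M)) < card (L e - {\<alpha>})"
      proof (cases "\<alpha> \<in> L e")
        case False
        then show ?thesis using le Le by simp
      next
        case True
        then obtain e' where e': "e' \<in> M" "snd e' = snd e \<and> f e' < f e \<or> fst e' = fst e \<and> g e' < g e"
          using M(4)[of e] e by (auto simp: F\<alpha>_def)
        then have "?A (F - M) \<subset> ?A F \<or> ?B (F - M) \<subset> ?B F"
          using MF by auto
        then have "card (?A (F - M)) < card (?A F) \<or> card (?B (F - M)) < card (?B F)"
          using fin psubset_card_mono by blast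
        then show ?thesis using le Le True by (auto simp: card_Diff_singleton)
      qed
      then show "finite (L e - {\<alpha>}) \<and> card (?A (F - M)) + card (?B (F - M)) < card (L e - {\<alpha>})"
        using Le by simp
    qed (use less.prems in auto)
    then obtain c where c: "proper_edge_coloring (F - M) c" "\<And>e. e \<in> F - M \<Longrightarrow> c e \<in> L e - {\<alpha>}"
      by blast
    define c' where "c' e = (if e \<in> M then \<alpha> else c e)" for e
    have "proper_edge_coloring F c'"
      unfolding proper_edge_coloring_def
    proof (intro ballI impI)
      fix e e' assume "e \<in> F" "e' \<in> F" "e \<noteq> e' \<and> (fst e = fst e' \<or> snd e = snd e')"
      then show "c' e \<noteq> c' e'"
        using c(1) c(2)[of e] c(2)[of e'] inj_onD[OF M(2), of e e'] inj_onD[OF M(3), of e e']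
        unfolding c'_def proper_edge_coloring_def by (cases "e \<in> M"; cases "e' \<in> M") auto
    qed
    moreover have "\<forall>e\<in>F. c' e \<in> L e"
      using c(2) M(1) by (auto simp: c'_def F\<alpha>_def)
    ultimately show ?thesis by (intro exI[of _ c'] conjI)
  qed
qed

text \<open>The edges at each vertex of the second class are cut into blocks of size \<open>i\<close>, where only the
  last block may be shorter. The blocks turn the graph into one of maximum degree \<open>i\<close>, which has
  a proper colouring with \<open>i\<close> colours; preferring later blocks, and smaller colours inside a block,
  at the second class, and larger colours at the first one, meets Galvin's bound.\<close>

theorem bipartite_list_edge_coloring:
  fixes F :: "('u \<times> 'w) set" and L :: "'u \<times> 'w \<Rightarrow> 'c set"
  assumes fin: "finite F" and dU: "\<And>u. card {e \<in> F. fst e = u} \<le> i"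
    and L: "\<And>e. e \<in> F \<Longrightarrow> finite (L e) \<and> i \<le> card (L e) \<and> card {e' \<in> F. snd e' = snd e} \<le> card (L e)"
  shows "\<exists>c. proper_edge_coloring F c \<and> (\<forall>e\<in>F. c e \<in> L e)"
proof (cases "F = {}")
  case True
  then show ?thesis by (simp add: proper_edge_coloring_def)
next
  case False
  then obtain u1 w1 where "(u1, w1) \<in> F" by auto
  then have "card {e \<in> F. fst e = u1} \<noteq> 0"
    using fin by (subst card_0_eq) auto
  then have i: "i > 0" using dU[of u1] by linarith
  define d where "d w = card {e \<in> F. snd e = w}" for w
  have "\<exists>h. bij_betw h {e \<in> F. snd e = w} {..<d w}" for w
    using ex_bij_betw_finite_nat[of "{e \<in> F. snd e = w}"] fin
    by (simp add: d_def lessThan_atLeast0)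
  then have "\<exists>hh. \<forall>w. bij_betw (hh w) {e \<in> F. snd e = w} {..<d w}"
    by (intro choice allI)
  then obtain hh where hh: "\<And>w. bij_betw (hh w) {e \<in> F. snd e = w} {..<d w}" by blast
  define h where "h e = hh (snd e) e" for e
  have hinj: "e = e'" if "e \<in> F" "e' \<in> F" "snd e = snd e'" "h e = h e'" for e e'
    using inj_onD[OF bij_betw_imp_inj_on[OF hh[of "snd e"]], of e e'] that by (simp add: h_def)
  have hlt: "h e < d (snd e)" if "e \<in> F" for e
    using bij_betw_apply[OF hh[of "snd e"], of e] that by (simp add: h_def)
  define b where "b e = h e div i" for e
  define sp where "sp e = (fst e, (snd e, b e))" for e :: "'u \<times> 'w"
  have sp_inj: "inj_on sp F" by (auto simp: inj_on_def sp_def prod_eq_iff)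
  have "\<exists>c. proper_edge_coloring (sp ` F) c \<and> c ` sp ` F \<subseteq> {..<i}"
  proof (rule bipartite_edge_coloring)
    show "finite (sp ` F)" using fin by simp
    fix u
    have "{e \<in> sp ` F. fst e = u} = sp ` {e \<in> F. fst e = u}" by (auto simp: sp_def)
    then show "card {e \<in> sp ` F. fst e = u} \<le> i"
      using dU[of u] card_image_le[of "{e \<in> F. fst e = u}" sp] fin by auto
  next
    fix wb :: "'w \<times> nat"
    obtain w j where wb: "wb = (w, j)" by (cases wb)
    let ?S = "{e \<in> F. snd e = w \<and> b e = j}"
    have "{e \<in> sp ` F. snd e = wb} = sp ` ?S" by (auto simp: sp_def wb)
    then have "card {e \<in> sp ` F. snd e = wb} \<le> card ?S"
      using card_image_le[of ?S sp] fin by auto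
    also have "card ?S = card (h ` ?S)"
      by (rule card_image[symmetric], rule inj_onI) (use hinj in auto)
    also have "\<dots> \<le> card {j * i..<j * i + i}"
    proof (rule card_mono)
      show "h ` ?S \<subseteq> {j * i..<j * i + i}"
      proof safe
        fix x assume "x \<in> F" "j = b x"
        moreover have "h x = b x * i + h x mod i" "h x mod i < i"
          using i by (simp_all add: b_def)
        ultimately show "h x \<in> {b x * i..<b x * i + i}" by auto
      qed
    qed simp
    finally show "card {e \<in> sp ` F. snd e = wb} \<le> i" by simp
  qed
  then obtain c0 where c0: "proper_edge_coloring (sp ` F) c0" "c0 ` sp ` F \<subseteq> {..<i}" by blast
  define c where "c e = c0 (sp e)" for e
  have c_ne: "c e \<noteq> c e'" if "e \<in> F" "e' \<in> F" "e \<noteq> e'" "fst (sp e) = fst (sp e') \<or> snd (sp e) = snd (sp e')"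
    for e e'
    using c0(1) that inj_onD[OF sp_inj, of e e'] unfolding proper_edge_coloring_def c_def by blast
  have cU: "c e \<noteq> c e'" if "e \<in> F" "e' \<in> F" "e \<noteq> e'" "fst e = fst e'" for e e'
    using c_ne[of e e'] that by (simp add: sp_def)
  have cW: "c e \<noteq> c e'" if "e \<in> F" "e' \<in> F" "e \<noteq> e'" "snd e = snd e'" "b e = b e'" for e e'
    using c_ne[of e e'] that by (simp add: sp_def)
  have cr: "c e < i" if "e \<in> F" for e using c0(2) that by (auto simp: c_def)
  define N where "N = Max (insert 0 (b ` F))"
  have bN: "b e \<le> N" if "e \<in> F" for e using that fin by (auto simp: N_def)
  \<comment> \<open>The factor \<open>i\<close> exceeds every colour, so \<open>f\<close> compares
    blocks first, last blocks in front, and then colours, while \<open>g\<close> reverses the order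
    of colours.\<close>
  define f where "f e = (N - b e) * i + c e" for e
  define g where "g e = i - c e" for e
  have fless: "b e < b e' \<or> b e = b e' \<and> c e' < c e" if "e \<in> F" "e' \<in> F" "f e' < f e" for e e'
  proof (rule ccontr)
    assume "\<not> ?thesis"
    then have "b e' < b e \<or> b e = b e' \<and> c e \<le> c e'" by auto
    then have "f e \<le> f e'"
    proof
      assume "b e' < b e"
      then have "(N - b e) + 1 \<le> N - b e'" using bN that by (metis Suc_eq_plus1 Suc_leI diff_less_mono2 less_le_trans)
      then have "((N - b e) + 1) * i \<le> (N - b e') * i" by (rule mult_le_mono1)
      then show ?thesis using cr[of e] that by (simp add: f_def)
    qed (simp add: f_def)
    then show False using that by simp
  qed
  have finj: "e = e'" if "e \<in> F" "e' \<in> F" "snd e = snd e'" "f e = f e'" for e e'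
  proof -
    have fd: "f x div i = N - b x" if "x \<in> F" for x
      using cr[OF that] i by (simp add: f_def)
    have "b e = b e'" using fd[of e] fd[of e'] bN[of e] bN[of e'] that by simp
    moreover from this have "c e = c e'" using that by (simp add: f_def)
    ultimately show ?thesis using cW that by blast
  qed
  show ?thesis
  proof (rule galvin_kernel[OF fin])
    fix e e' assume "e \<in> F" "e' \<in> F" "fst e = fst e'" "g e = g e'"
    then show "e = e'" using cU[of e e'] cr[of e] cr[of e'] by (fastforce simp: g_def)
  next
    fix e assume e: "e \<in> F"
    let ?A = "{e' \<in> F. snd e' = snd e \<and> f e' < f e}"
    let ?A1 = "{e' \<in> F. snd e' = snd e \<and> b e < b e'}"
    let ?A2 = "{e' \<in> F. snd e' = snd e \<and> b e = b e' \<and> c e' < c e}"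
    let ?B = "{e' \<in> F. fst e' = fst e \<and> g e' < g e}"
    have "?A \<subseteq> ?A1 \<union> ?A2" using fless[OF e] by blast
    then have "card ?A \<le> card (?A1 \<union> ?A2)" using fin by (intro card_mono) auto
    also have "\<dots> \<le> card ?A1 + card ?A2" by (rule card_Un_le)
    finally have A: "card ?A \<le> card ?A1 + card ?A2" .
    have "card ?A1 = card (h ` ?A1)"
      by (rule card_image[symmetric], rule inj_onI) (use hinj in auto)
    also have "\<dots> \<le> card {i..<d (snd e)}"
    proof (rule card_mono)
      show "h ` ?A1 \<subseteq> {i..<d (snd e)}"
      proof safe
        fix e' assume e': "e' \<in> F" "snd e' = snd e" "b e < b e'"
        then have "h e' div i \<ge> 1" by (simp add: b_def)
        then have "h e' \<ge> i" using i by (metis div_less not_less not_one_le_zero)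
        then show "h e' \<in> {i..<d (snd e)}" using hlt[of e'] e' by auto
      qed
    qed simp
    finally have A1: "card ?A1 \<le> d (snd e) - i" by simp
    have "card ?A2 = card (c ` ?A2)"
      by (rule card_image[symmetric], rule inj_onI) (use cW in \<open>metis (mono_tags, lifting) mem_Collect_eq\<close>)
    also have "\<dots> \<le> card {..<c e}" by (rule card_mono) auto
    finally have A2: "card ?A2 \<le> c e" by simp
    have "card ?B = card (c ` ?B)"
      by (rule card_image[symmetric], rule inj_onI) (use cU in \<open>metis (mono_tags, lifting) mem_Collect_eq\<close>)
    also have "\<dots> \<le> card {c e<..<i}" by (rule card_mono) (auto simp: g_def cr)
    finally have B: "card ?B \<le> i - Suc (c e)" by simp
    \<comment> \<open>With d(w) edges at the second end, later blocks lie beyond the first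
      \<open>i\<close> of them and hold at most d(w) - i, truncated at 0; the own block adds at most
      c(e) and the first class at most i - 1 - c(e). The sum is at most max(d(w), i) - 1.\<close>
    have "card ?A + card ?B < card (L e)"
      using A A1 A2 B L[OF e] cr[OF e] d_def[of "snd e"] by linarith
    then show "finite (L e) \<and> card ?A + card ?B < card (L e)"
      using L[OF e] by blast
  qed (use finj in auto)
qed

section \<open>Arcs in the plane\<close>

lemma connected_subset_inside:
  assumes "connected T" "T \<inter> S = {}" "T \<inter> inside S \<noteq> {}"
  shows "T \<subseteq> inside S"
proof
  fix y assume y: "y \<in> T"
  obtain x where x: "x \<in> T" "x \<in> inside S" using assms(3) by blast
  have "T \<subseteq> - S" using assms(2) by blast
  then have "connected_component (- S) x y"
    unfolding connected_component_def using assms(1) x y by blast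
  then show "y \<in> inside S" using inside_same_component x(2) by blast
qed

lemma connected_subset_outside:
  assumes "connected T" "T \<inter> S = {}" "T \<inter> outside S \<noteq> {}"
  shows "T \<subseteq> outside S"
proof (rule ccontr)
  assume "\<not> ?thesis"
  then have "T \<inter> inside S \<noteq> {}"
    using assms(2) inside_Un_outside[of S] by blast
  then have "T \<subseteq> inside S" using connected_subset_inside assms by blast
  then show False using assms(3) inside_Int_outside[of S] by blast
qed

lemma connected_arc_startless:
  assumes "arc c"
  shows "connected (path_image c - {pathstart c})"
proof -
  have "path_image c - {pathstart c} = c ` {0<..1}"
  proof
    show "path_image c - {pathstart c} \<subseteq> c ` {0<..1}"
      by (force simp: path_image_def pathstart_def less_le)
    have "c t \<noteq> c 0" if "t \<in> {0<..1}" for t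
      using assms that unfolding arc_def inj_on_def by force
    then show "c ` {0<..1} \<subseteq> path_image c - {pathstart c}"
      by (auto simp: path_image_def pathstart_def)
  qed
  moreover have "continuous_on {0<..1} c"
    by (rule continuous_on_subset[OF arc_imp_path[OF assms, unfolded path_def]]) auto
  ultimately show ?thesis by (simp add: connected_continuous_image)
qed

lemma connected_arc_finishless:
  assumes "arc c"
  shows "connected (path_image c - {pathfinish c})"
  using connected_arc_startless[OF arc_reversepath[OF assms]] by simp

lemma theta_arcs_join:
  assumes "arc c1" "pathstart c1 = a" "pathfinish c1 = b"
    and "arc c2" "pathstart c2 = a" "pathfinish c2 = b"
    and "path_image c1 \<inter> path_image c2 = {a, b}"
  shows "simple_path (c1 +++ reversepath c2)" "path_image (c1 +++ reversepath c2) = path_image c1 \<union> path_image c2"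
  using assms by (auto intro!: simple_path_join_loop simp: path_image_join arc_reversepath)

text \<open>Of three arcs with common end points, some cycle has the third arc on its inside: at a point
  enclosed by \<open>c1\<close> and \<open>c2\<close> the winding numbers of the three cycles add up to zero.\<close>

lemma theta_inside:
  fixes c1 c2 c :: "real \<Rightarrow> complex"
  assumes c1: "arc c1" "pathstart c1 = a" "pathfinish c1 = b"
    and c2: "arc c2" "pathstart c2 = a" "pathfinish c2 = b"
    and c: "arc c" "pathstart c = a" "pathfinish c = b"
    and I12: "path_image c1 \<inter> path_image c2 = {a, b}"
    and I1: "path_image c1 \<inter> path_image c = {a, b}"
    and I2: "path_image c2 \<inter> path_image c = {a, b}"
    and out: "path_image c \<inter> inside (path_image c1 \<union> path_image c2) = {}"
  shows "inside (path_image c1 \<union> path_image c2) \<union> (path_image c1 - {a, b}) \<subseteq> inside (path_image c2 \<union> path_image c) \<or>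
         inside (path_image c1 \<union> path_image c2) \<union> (path_image c2 - {a, b}) \<subseteq> inside (path_image c1 \<union> path_image c)"
proof -
  let ?I = "inside (path_image c1 \<union> path_image c2)"
  note s12 = theta_arcs_join[OF c1 c2 I12]
  note s1 = theta_arcs_join[OF c1 c I1]
  note s2 = theta_arcs_join[OF c2 c I2]
  have J: "?I \<noteq> {}" "connected ?I" "frontier ?I = path_image c1 \<union> path_image c2" "open ?I"
    using Jordan_inside_outside[OF s12(1)] c1 c2 unfolding s12(2) by simp_all
  have no: "?I \<inter> (path_image c1 \<union> path_image c2) = {}" by (rule inside_no_overlap)
  have paths: "path c1" "path c2" "path c" using c1 c2 c by (auto simp: arc_imp_path)
  obtain z where z: "z \<in> ?I" using J(1) by blast
  then have zn: "z \<notin> path_image c1" "z \<notin> path_image c2" "z \<notin> path_image c"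
    using no out by blast+
  have wn: "winding_number (d1 +++ reversepath d2) z = winding_number d1 z - winding_number d2 z"
    if "path d1" "path d2" "z \<notin> path_image d1" "z \<notin> path_image d2" "pathfinish d1 = pathfinish d2" for d1 d2
    using that by (simp add: winding_number_join winding_number_reversepath)
  have "\<not> (z \<in> outside (path_image c1 \<union> path_image c) \<and> z \<in> outside (path_image c2 \<union> path_image c))"
  proof
    assume zo: "z \<in> outside (path_image c1 \<union> path_image c) \<and> z \<in> outside (path_image c2 \<union> path_image c)"
    have "winding_number (c1 +++ reversepath c) z = 0"
      by (rule winding_number_zero_in_outside) (use zo s1(2) paths c1 c in auto)
    moreover have "winding_number (c2 +++ reversepath c) z = 0"
      by (rule winding_number_zero_in_outside) (use zo s2(2) paths c2 c in auto)
    ultimately have "winding_number (c1 +++ reversepath c2) z = 0"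
      using wn[of c1 c] wn[of c2 c] wn[of c1 c2] zn paths c1 c2 c by simp
    then show False
      using simple_closed_path_norm_winding_number_inside[OF s12(1), of z] z unfolding s12(2) by simp
  qed
  then have "z \<in> inside (path_image c1 \<union> path_image c) \<or> z \<in> inside (path_image c2 \<union> path_image c)"
    using zn inside_Un_outside[of "path_image c1 \<union> path_image c"] inside_Un_outside[of "path_image c2 \<union> path_image c"]
    by blast
  moreover have key: "?I \<union> (path_image d - {a, b}) \<subseteq> inside (path_image d' \<union> path_image c)"
    if zi: "z \<in> inside (path_image d' \<union> path_image c)" and d: "d = c1 \<and> d' = c2 \<or> d = c2 \<and> d' = c1" for d d'
  proof -
    have I: "?I \<subseteq> inside (path_image d' \<union> path_image c)"
    proof (rule connected_subset_inside[OF J(2)])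
      show "?I \<inter> (path_image d' \<union> path_image c) = {}" using no out d by blast
      show "?I \<inter> inside (path_image d' \<union> path_image c) \<noteq> {}" using z zi by blast
    qed
    have cl: "closed (path_image d' \<union> path_image c)"
      using d c1 c2 c by (auto intro!: closed_Un closed_arc_image)
    \<comment> \<open>Both \<open>c1\<close> and \<open>c2\<close> belong to the frontier of the old
      inside, so the arc left out of the new cycle is enclosed along with it.\<close>
    have "path_image d \<subseteq> closure ?I"
      using J(3) d by (auto simp: frontier_def)
    also have "\<dots> \<subseteq> closure (inside (path_image d' \<union> path_image c))" by (rule closure_mono[OF I])
    also have "\<dots> \<subseteq> path_image d' \<union> path_image c \<union> inside (path_image d' \<union> path_image c)"
      by (rule closure_inside_subset[OF cl])
    finally show ?thesis using I d I12 I1 I2 by blast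
  qed
  ultimately show ?thesis using key[of c2 c1] key[of c1 c2] by blast
qed

section \<open>Paths as vertex lists\<close>

fun edges_of :: "'a list \<Rightarrow> 'a set set" where
  "edges_of (x # y # zs) = insert {x, y} (edges_of (y # zs))"
| "edges_of _ = {}"

lemma edges_of_append: "edges_of (xs @ x # ys) = edges_of (xs @ [x]) \<union> edges_of (x # ys)"
proof (induction xs)
  case (Cons a xs)
  then show ?case by (cases xs) auto
qed simp

lemma edges_of_rev [simp]: "edges_of (rev xs) = edges_of xs"
proof (induction xs rule: edges_of.induct)
  case (1 x y zs)
  have "edges_of (rev (x # y # zs)) = edges_of (rev zs @ y # [x])" by simp
  also have "\<dots> = edges_of (rev (y # zs)) \<union> {{x, y}}"
    unfolding edges_of_append[of "rev zs" y "[x]"] by (simp add: insert_commute)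
  finally show ?case using 1 by simp
qed auto

lemma edges_of_subset: "e \<in> edges_of xs \<Longrightarrow> e \<subseteq> set xs"
  by (induction xs rule: edges_of.induct) auto

lemma Union_edges_of: "2 \<le> length xs \<Longrightarrow> \<Union> (edges_of xs) = set xs"
proof (induction xs rule: edges_of.induct)
  case (1 x y zs)
  then show ?case by (cases zs) auto
qed auto

lemma finite_edges_of [simp]: "finite (edges_of xs)"
  by (induction xs rule: edges_of.induct) auto

lemma card_edges_of: "card (edges_of xs) \<le> length xs - 1"
proof (induction xs rule: edges_of.induct)
  case (1 x y zs)
  then show ?case by (auto intro: order_trans[OF card_insert_le_m1])
qed auto

text \<open>Serves to rule out the degenerate cycle whose two paths are the same single
  edge.\<close>

lemma edges_of_ends:
  assumes "distinct xs" "{hd xs, last xs} \<in> edges_of xs" "2 \<le> length xs"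
  shows "length xs = 2"
proof -
  obtain x y zs where xs: "xs = x # y # zs"
    using assms(3) by (cases xs rule: edges_of.cases) auto
  have "x \<notin> set (y # zs)" using assms(1) xs by simp
  then have "{hd xs, last xs} \<notin> edges_of (y # zs)"
    using edges_of_subset[of _ "y # zs"] xs by fastforce
  then have "{x, last (y # zs)} = {x, y}" using assms(2) xs by auto
  then have "last (y # zs) = y" by (auto simp: doubleton_eq_iff)
  then have "zs = []" using assms(1) xs by (cases zs rule: rev_cases) auto
  then show ?thesis using xs by simp
qed

section \<open>Plane drawings and the two sides of a set of edges\<close>

locale plane_graph =
  fixes V :: "'a set" and E :: "'a set set" and pos :: "'a \<Rightarrow> complex" and \<gamma> :: "'a set \<Rightarrow> real \<Rightarrow> complex"
  assumes finite_V: "finite V"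
    and edge: "\<And>e. e \<in> E \<Longrightarrow> e \<subseteq> V \<and> card e = 2"
    and inj_pos: "inj_on pos V"
    and arc_edge: "\<And>e. e \<in> E \<Longrightarrow> arc (\<gamma> e)"
    and ends_edge: "\<And>e. e \<in> E \<Longrightarrow> {pathstart (\<gamma> e), pathfinish (\<gamma> e)} = pos ` e"
    and edge_vertices: "\<And>e. e \<in> E \<Longrightarrow> path_image (\<gamma> e) \<inter> pos ` V = pos ` e"
    and edge_cross: "\<And>e e'. e \<in> E \<Longrightarrow> e' \<in> E \<Longrightarrow> e \<noteq> e' \<Longrightarrow>
      path_image (\<gamma> e) \<inter> path_image (\<gamma> e') \<subseteq> pos ` (e \<inter> e')"
begin

lemma finite_E: "finite E"
  by (rule finite_subset[of _ "Pow V"]) (use edge finite_V in auto)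

definition img :: "'a set set \<Rightarrow> complex set" where
  "img P = (\<Union>e\<in>P. path_image (\<gamma> e))"

text \<open>The ends are removed because they may lie on \<open>img P\<close>; what remains is
  connected and avoids \<open>img P\<close> whenever the edge is not in \<open>P\<close>, hence lies
  entirely on one side.\<close>

definition open_edge :: "'a set \<Rightarrow> complex set" where
  "open_edge e = path_image (\<gamma> e) - pos ` e"

definition IE :: "'a set set \<Rightarrow> 'a set set" where
  "IE P = {e \<in> E. open_edge e \<subseteq> inside (img P)}"

definition OE :: "'a set set \<Rightarrow> 'a set set" where
  "OE P = {e \<in> E. open_edge e \<subseteq> outside (img P)}"

definition IV :: "'a set set \<Rightarrow> 'a set" where
  "IV P = {v \<in> V. pos v \<in> inside (img P)}"

definition OV :: "'a set set \<Rightarrow> 'a set" where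
  "OV P = {v \<in> V. pos v \<in> outside (img P)}"

lemma finite_sets [simp]: "finite (IE P)" "finite (OE P)" "finite (IV P)" "finite (OV P)"
  using finite_V finite_E by (auto simp: IE_def OE_def IV_def OV_def)

lemma pos_in_path_image:
  assumes "e \<in> E" "v \<in> V"
  shows "pos v \<in> path_image (\<gamma> e) \<longleftrightarrow> v \<in> e"
proof -
  have "pos v \<in> path_image (\<gamma> e) \<longleftrightarrow> pos v \<in> pos ` e"
    using edge_vertices[OF assms(1)] assms(2) by blast
  then show ?thesis using inj_pos assms edge[OF assms(1)] by (auto dest: inj_onD)
qed

lemma pos_in_img:
  assumes "P \<subseteq> E" "v \<in> V"
  shows "pos v \<in> img P \<longleftrightarrow> v \<in> \<Union>P"
  unfolding img_def using pos_in_path_image assms by auto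

lemma connected_open_edge: "e \<in> E \<Longrightarrow> connected (open_edge e)"
  and open_edge_nonempty: "e \<in> E \<Longrightarrow> open_edge e \<noteq> {}"
  unfolding open_edge_def
  using ends_edge[symmetric] connected_simple_path_endless[OF arc_imp_simple_path[OF arc_edge]]
    nonempty_simple_path_endless[OF arc_imp_simple_path[OF arc_edge]] by simp_all

lemma open_edge_img:
  assumes "P \<subseteq> E" "e \<in> E" "e \<notin> P"
  shows "open_edge e \<inter> img P = {}"
proof -
  have "path_image (\<gamma> e) \<inter> path_image (\<gamma> e') \<subseteq> pos ` e" if "e' \<in> P" for e'
    using edge_cross[of e e'] assms that by blast
  then show ?thesis unfolding open_edge_def img_def by blast
qed

lemma open_edge_in_img: "e \<in> P \<Longrightarrow> open_edge e \<subseteq> img P"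
  unfolding open_edge_def img_def by blast

lemma IE_disjoint: "IE P \<inter> P = {}"
proof -
  have False if "e \<in> E" "open_edge e \<subseteq> inside (img P)" "e \<in> P" for e
    using that inside_no_overlap[of "img P"] open_edge_in_img[of e P] open_edge_nonempty[of e] by blast
  then show ?thesis by (auto simp: IE_def)
qed

lemma OE_disjoint: "OE P \<inter> P = {}"
proof -
  have False if "e \<in> E" "open_edge e \<subseteq> outside (img P)" "e \<in> P" for e
    using that outside_no_overlap[of "img P"] open_edge_in_img[of e P] open_edge_nonempty[of e] by blast
  then show ?thesis by (auto simp: OE_def)
qed

lemma edge_inside_or_outside:
  assumes "P \<subseteq> E"
  shows "E \<subseteq> P \<union> IE P \<union> OE P"
proof
  fix e assume e: "e \<in> E"
  show "e \<in> P \<union> IE P \<union> OE P"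
  proof (cases "e \<in> P")
    case False
    have d: "open_edge e \<inter> img P = {}" using open_edge_img[OF assms e False] .
    obtain x where x: "x \<in> open_edge e" using open_edge_nonempty[OF e] by blast
    then consider "x \<in> inside (img P)" | "x \<in> outside (img P)"
      using d inside_Un_outside[of "img P"] by blast
    then show ?thesis
      using connected_subset_inside[OF connected_open_edge[OF e] d]
        connected_subset_outside[OF connected_open_edge[OF e] d] x e
      unfolding IE_def OE_def by cases auto
  qed simp
qed

lemma vertex_inside_or_outside:
  assumes "P \<subseteq> E"
  shows "V = (\<Union>P) \<union> IV P \<union> OV P" "(\<Union>P) \<inter> IV P = {}" "(\<Union>P) \<inter> OV P = {}" "IV P \<inter> OV P = {}"
proof -
  have P: "\<Union>P \<subseteq> V" using assms edge by blast
  have *: "v \<in> \<Union>P \<longleftrightarrow> pos v \<in> img P" if "v \<in> V" for v using pos_in_img[OF assms that] by simp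
  show "V = (\<Union>P) \<union> IV P \<union> OV P"
    using P * inside_Un_outside[of "img P"] unfolding IV_def OV_def by blast
  show "(\<Union>P) \<inter> IV P = {}" "(\<Union>P) \<inter> OV P = {}"
    using * inside_no_overlap[of "img P"] outside_no_overlap[of "img P"] unfolding IV_def OV_def by blast+
  show "IV P \<inter> OV P = {}"
    using inside_Int_outside[of "img P"] unfolding IV_def OV_def by blast
qed

text \<open>Carries the side of an edge over to an end that is not on the curve: with that end added
  the open edge is still connected and still avoids the curve.\<close>

lemma half_open_edge:
  assumes "e \<in> E" "v \<in> e"
  shows "connected (insert (pos v) (open_edge e))"
proof -
  have ne: "pathstart (\<gamma> e) \<noteq> pathfinish (\<gamma> e)" using arc_distinct_ends[OF arc_edge[OF assms(1)]] by simp
  have pe: "pos ` e = {pathstart (\<gamma> e), pathfinish (\<gamma> e)}" using ends_edge[OF assms(1)] by simp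
  then have "pos v = pathstart (\<gamma> e) \<or> pos v = pathfinish (\<gamma> e)" using assms(2) by blast
  then have "insert (pos v) (open_edge e) = path_image (\<gamma> e) - {pathfinish (\<gamma> e)} \<or>
             insert (pos v) (open_edge e) = path_image (\<gamma> e) - {pathstart (\<gamma> e)}"
    unfolding open_edge_def pe using ne pathstart_in_path_image[of "\<gamma> e"] pathfinish_in_path_image[of "\<gamma> e"] by auto
  then show ?thesis
    using connected_arc_startless[OF arc_edge[OF assms(1)]] connected_arc_finishless[OF arc_edge[OF assms(1)]] by metis
qed

lemma IE_endpoints:
  assumes "P \<subseteq> E" "e \<in> IE P"
  shows "e \<subseteq> \<Union>P \<union> IV P"
proof
  fix v assume v: "v \<in> e"
  have e: "e \<in> E" "open_edge e \<subseteq> inside (img P)" using assms(2) by (auto simp: IE_def)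
  have vV: "v \<in> V" using edge e v by blast
  show "v \<in> \<Union>P \<union> IV P"
  proof (cases "v \<in> \<Union>P")
    case False
    then have "pos v \<notin> img P" using pos_in_img[OF assms(1) vV] by simp
    then have "insert (pos v) (open_edge e) \<subseteq> inside (img P)"
      using e open_edge_nonempty[OF e(1)] inside_no_overlap[of "img P"]
      by (intro connected_subset_inside half_open_edge v) blast+
    then show ?thesis using vV by (simp add: IV_def)
  qed simp
qed

lemma OE_endpoints:
  assumes "P \<subseteq> E" "e \<in> OE P"
  shows "e \<subseteq> \<Union>P \<union> OV P"
proof
  fix v assume v: "v \<in> e"
  have e: "e \<in> E" "open_edge e \<subseteq> outside (img P)" using assms(2) by (auto simp: OE_def)
  have vV: "v \<in> V" using edge e v by blast
  show "v \<in> \<Union>P \<union> OV P"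
  proof (cases "v \<in> \<Union>P")
    case False
    then have "pos v \<notin> img P" using pos_in_img[OF assms(1) vV] by simp
    then have "insert (pos v) (open_edge e) \<subseteq> outside (img P)"
      using e open_edge_nonempty[OF e(1)] outside_no_overlap[of "img P"]
      by (intro connected_subset_outside half_open_edge v) blast+
    then show ?thesis using vV by (simp add: OV_def)
  qed simp
qed

lemma img_Int:
  assumes "P \<subseteq> E" "Q \<subseteq> E" "P \<inter> Q = {}"
  shows "img P \<inter> img Q \<subseteq> pos ` (\<Union>P \<inter> \<Union>Q)"
proof
  fix x assume "x \<in> img P \<inter> img Q"
  then obtain e f where ef: "e \<in> P" "f \<in> Q" "x \<in> path_image (\<gamma> e) \<inter> path_image (\<gamma> f)"
    unfolding img_def by blast
  then have "x \<in> pos ` (e \<inter> f)" using edge_cross[of e f] assms by blast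
  then show "x \<in> pos ` (\<Union>P \<inter> \<Union>Q)" using ef by blast
qed

lemma img_Un: "img (P \<union> Q) = img P \<union> img Q"
  by (auto simp: img_def)

section \<open>Paths and cycles of the drawing as arcs and closed curves\<close>

definition gpath :: "'a list \<Rightarrow> bool" where
  "gpath xs \<longleftrightarrow> distinct xs \<and> 2 \<le> length xs \<and> edges_of xs \<subseteq> E"

lemma oriented_edge:
  assumes "{x, y} \<in> E"
  obtains g where "arc g" "pathstart g = pos x" "pathfinish g = pos y" "path_image g = path_image (\<gamma> {x, y})"
proof (cases "pathstart (\<gamma> {x, y}) = pos x")
  case True
  then have "pathfinish (\<gamma> {x, y}) = pos y"
    using ends_edge[OF assms] arc_distinct_ends[OF arc_edge[OF assms]] by (auto simp: doubleton_eq_iff)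
  then show ?thesis using that[of "\<gamma> {x, y}"] True arc_edge[OF assms] by blast
next
  case False
  then have "pathstart (\<gamma> {x, y}) = pos y" "pathfinish (\<gamma> {x, y}) = pos x"
    using ends_edge[OF assms] by (auto simp: doubleton_eq_iff)
  then show ?thesis using that[of "reversepath (\<gamma> {x, y})"] arc_reversepath[OF arc_edge[OF assms]] by simp
qed

lemma gpath_arc:
  assumes "gpath xs"
  shows "\<exists>g. arc g \<and> pathstart g = pos (hd xs) \<and> pathfinish g = pos (last xs) \<and> path_image g = img (edges_of xs)"
  using assms
proof (induction xs rule: edges_of.induct)
  case (1 x y zs)
  have xy: "{x, y} \<in> E" and x: "x \<notin> set (y # zs)" using 1 by (auto simp: gpath_def)
  obtain g where g: "arc g" "pathstart g = pos x" "pathfinish g = pos y" "path_image g = path_image (\<gamma> {x, y})"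
    using oriented_edge[OF xy] by blast
  show ?case
  proof (cases zs)
    case Nil
    then show ?thesis using g by (auto simp: img_def)
  next
    case (Cons z zs')
    then have p: "gpath (y # zs)" using 1 by (auto simp: gpath_def)
    then obtain h where h: "arc h" "pathstart h = pos y" "pathfinish h = pos (last (y # zs))"
      "path_image h = img (edges_of (y # zs))"
      using 1 by auto
    have ne: "{x, y} \<notin> edges_of (y # zs)" using edges_of_subset[of "{x, y}" "y # zs"] x by blast
    have "img {{x, y}} \<inter> img (edges_of (y # zs)) \<subseteq> pos ` (\<Union>{{x, y}} \<inter> \<Union>(edges_of (y # zs)))"
      using xy p ne by (intro img_Int) (auto simp: gpath_def)
    also have "\<Union>(edges_of (y # zs)) = set (y # zs)" by (rule Union_edges_of) (simp add: Cons)
    also have "\<Union>{{x, y}} \<inter> set (y # zs) = {y}" using x by auto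
    finally have "path_image g \<inter> path_image h \<subseteq> {pathstart h}"
      by (simp add: g h img_def)
    then have "arc (g +++ h)" using g h by (intro arc_join) auto
    moreover have "path_image (g +++ h) = img (edges_of (x # y # zs))"
      using g h by (simp add: path_image_join img_def)
    ultimately show ?thesis using g h by (intro exI[of _ "g +++ h"]) auto
  qed
qed (auto simp: gpath_def)

text \<open>A cycle is kept as two paths between a chosen pair of its vertices, the form in which a
  third path turns it into a theta curve. Disjointness of the edge sets excludes two copies of one
  edge.\<close>

definition gcycle :: "'a list \<Rightarrow> 'a list \<Rightarrow> bool" where
  "gcycle xs ys \<longleftrightarrow> gpath xs \<and> gpath ys \<and> hd xs = hd ys \<and> last xs = last ys \<and>
     set xs \<inter> set ys = {hd xs, last xs} \<and> edges_of xs \<inter> edges_of ys = {}"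

lemma gpath_Union: "gpath xs \<Longrightarrow> \<Union>(edges_of xs) = set xs"
  using Union_edges_of by (auto simp: gpath_def)

lemma gpath_ends: "gpath xs \<Longrightarrow> hd xs \<in> set xs \<and> last xs \<in> set xs \<and> hd xs \<noteq> last xs"
  unfolding gpath_def by (cases xs rule: edges_of.cases) auto

lemma gcycle_img_Int:
  assumes "gcycle xs ys"
  shows "img (edges_of xs) \<inter> img (edges_of ys) = {pos (hd xs), pos (last xs)}"
proof
  have p: "gpath xs" "gpath ys" and h: "hd xs = hd ys" "last xs = last ys"
    "set xs \<inter> set ys = {hd xs, last xs}" "edges_of xs \<inter> edges_of ys = {}"
    using assms by (auto simp: gcycle_def)
  show "img (edges_of xs) \<inter> img (edges_of ys) \<subseteq> {pos (hd xs), pos (last xs)}"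
    using img_Int[of "edges_of xs" "edges_of ys"] p h gpath_Union unfolding gpath_def by auto
  have "v \<in> V" if "v \<in> set xs" for v
    using that gpath_Union[OF p(1)] p(1) edge unfolding gpath_def by blast
  moreover have "edges_of xs \<subseteq> E" "edges_of ys \<subseteq> E" using p by (auto simp: gpath_def)
  moreover have "v \<in> set xs \<and> v \<in> set ys" if "v \<in> {hd xs, last xs}" for v using that h(3) by blast
  ultimately have "pos v \<in> img (edges_of xs) \<and> pos v \<in> img (edges_of ys)" if "v \<in> {hd xs, last xs}" for v
    using pos_in_img[of "edges_of xs" v] pos_in_img[of "edges_of ys" v] that
    unfolding gpath_Union[OF p(1)] gpath_Union[OF p(2)] by simp
  then show "{pos (hd xs), pos (last xs)} \<subseteq> img (edges_of xs) \<inter> img (edges_of ys)" by auto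
qed

text \<open>The third path of a theta graph, possibly a single chord. That its edges are not on the
  cycle is obtained later from the side of the cycle on which they lie.\<close>

definition chordal_path :: "'a list \<Rightarrow> 'a list \<Rightarrow> 'a list \<Rightarrow> bool" where
  "chordal_path xs ys zs \<longleftrightarrow> gcycle xs ys \<and> gpath zs \<and> hd zs = hd xs \<and> last zs = last xs \<and>
     set zs \<inter> (set xs \<union> set ys) = {hd xs, last xs}"

lemma chordal_path_gcycle:
  assumes "chordal_path xs ys zs" "edges_of zs \<inter> (edges_of xs \<union> edges_of ys) = {}"
  shows "gcycle xs zs" "gcycle ys zs"
  using assms gpath_ends[of xs] gpath_ends[of ys] unfolding chordal_path_def gcycle_def by auto

lemma chordal_path_arcs:
  assumes "chordal_path xs ys zs" "edges_of zs \<inter> (edges_of xs \<union> edges_of ys) = {}"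
  obtains c1 c2 c a b where
    "arc c1" "pathstart c1 = a" "pathfinish c1 = b" "path_image c1 = img (edges_of xs)"
    "arc c2" "pathstart c2 = a" "pathfinish c2 = b" "path_image c2 = img (edges_of ys)"
    "arc c" "pathstart c = a" "pathfinish c = b" "path_image c = img (edges_of zs)"
    "path_image c1 \<inter> path_image c2 = {a, b}" "path_image c1 \<inter> path_image c = {a, b}"
    "path_image c2 \<inter> path_image c = {a, b}"
    "a = pos (hd xs)" "b = pos (last xs)"
proof -
  note c = chordal_path_gcycle[OF assms]
  have x: "gcycle xs ys" "hd zs = hd xs" "last zs = last xs" using assms by (auto simp: chordal_path_def)
  then have p: "gpath xs" "gpath ys" "gpath zs" "hd ys = hd xs" "last ys = last xs" 
    using c by (auto simp: gcycle_def)
  obtain c1 where c1: "arc c1" "pathstart c1 = pos (hd xs)" "pathfinish c1 = pos (last xs)" "path_image c1 = img (edges_of xs)"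
    using gpath_arc[OF p(1)] by blast
  obtain c2 where c2: "arc c2" "pathstart c2 = pos (hd xs)" "pathfinish c2 = pos (last xs)" "path_image c2 = img (edges_of ys)"
    using gpath_arc[OF p(2)] p by auto
  obtain c3 where c3: "arc c3" "pathstart c3 = pos (hd xs)" "pathfinish c3 = pos (last xs)" "path_image c3 = img (edges_of zs)"
    using gpath_arc[OF p(3)] x by auto
  show thesis
  proof (rule that[OF c1 c2 c3])
    show "path_image c1 \<inter> path_image c2 = {pos (hd xs), pos (last xs)}"
      unfolding c1(4) c2(4) by (rule gcycle_img_Int[OF x(1)])
    show "path_image c1 \<inter> path_image c3 = {pos (hd xs), pos (last xs)}"
      unfolding c1(4) c3(4) by (rule gcycle_img_Int[OF c(1)])
    show "path_image c2 \<inter> path_image c3 = {pos (hd xs), pos (last xs)}"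
      using gcycle_img_Int[OF c(2)] unfolding c2(4) c3(4) p(4,5) .
    show "pos (hd xs) = pos (hd xs)" "pos (last xs) = pos (last xs)" by (rule refl)+
  qed
qed

text \<open>The theta-curve theorem in terms of the graph: an inside edge that is not on
  \<open>zs\<close> misses the whole theta curve and so lies in one of the two parts. The 2 in the
  vertex count stands for the ends of \<open>zs\<close>, which are on the old cycle and not inside
  it.\<close>

lemma split_inside:
  assumes ch: "chordal_path xs ys zs" and zs: "edges_of zs \<subseteq> IE (edges_of xs \<union> edges_of ys)"
  defines "P \<equiv> edges_of xs \<union> edges_of ys"
    and "Q \<equiv> edges_of xs \<union> edges_of zs" and "R \<equiv> edges_of ys \<union> edges_of zs"
  shows "gcycle xs zs" "gcycle ys zs"
    "IE Q \<subseteq> IE P - edges_of zs" "IE R \<subseteq> IE P - edges_of zs"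
    "IE P \<subseteq> IE Q \<union> IE R \<union> edges_of zs"
    "card (IV Q) + card (IV R) + card (set zs) \<le> card (IV P) + 2"
proof -
  have dz: "edges_of zs \<inter> (edges_of xs \<union> edges_of ys) = {}" using zs IE_disjoint by blast
  note c = chordal_path_gcycle[OF ch dz]
  show "gcycle xs zs" "gcycle ys zs" by (rule c)+
  have p: "gpath xs" "gpath ys" "gpath zs" using c by (auto simp: gcycle_def)
  obtain c1 c2 c3 a b where cc: "arc c1" "pathstart c1 = a" "pathfinish c1 = b" "path_image c1 = img (edges_of xs)"
    "arc c2" "pathstart c2 = a" "pathfinish c2 = b" "path_image c2 = img (edges_of ys)"
    "arc c3" "pathstart c3 = a" "pathfinish c3 = b" "path_image c3 = img (edges_of zs)"
    "path_image c1 \<inter> path_image c2 = {a, b}" "path_image c1 \<inter> path_image c3 = {a, b}"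
    "path_image c2 \<inter> path_image c3 = {a, b}"
    "a = pos (hd xs)" "b = pos (last xs)"
    by (rule chordal_path_arcs[OF ch dz])
  have PE: "P \<subseteq> E" "Q \<subseteq> E" "R \<subseteq> E" "edges_of zs \<subseteq> E" using p by (auto simp: P_def Q_def R_def gpath_def)
  have "hd zs \<in> set zs" using gpath_ends p by blast
  then obtain e where e: "e \<in> edges_of zs" using gpath_Union[OF p(3)] by auto
  have ab: "a \<noteq> b" using arc_distinct_ends cc by blast
  have "open_edge e \<subseteq> path_image c3 \<inter> inside (path_image c1 \<union> path_image c2)"
    using e zs cc open_edge_in_img[OF e] unfolding IE_def img_Un by auto
  then have ne: "path_image c3 \<inter> inside (path_image c1 \<union> path_image c2) \<noteq> {}"
    using open_edge_nonempty[of e] e PE(4) by blast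
  have "inside (img Q) \<inter> inside (img R) = {} \<and> inside (img Q) \<union> inside (img R) \<union> (img (edges_of zs) - {a, b}) = inside (img P)"
    by (rule split_inside_simple_closed_curve[OF _ cc(2,3) _ cc(6,7) _ cc(10,11) ab cc(13-15) ne])
      (use cc in \<open>auto simp: arc_imp_simple_path P_def Q_def R_def img_Un\<close>)
  then have I: "inside (img Q) \<inter> inside (img R) = {}"
    "inside (img Q) \<union> inside (img R) \<union> (img (edges_of zs) - {a, b}) = inside (img P)" by auto
  have sub: "edges_of zs \<inter> IE Q = {}" "edges_of zs \<inter> IE R = {}"
    using IE_disjoint[of Q] IE_disjoint[of R] by (auto simp: Q_def R_def)
  then show "IE Q \<subseteq> IE P - edges_of zs" "IE R \<subseteq> IE P - edges_of zs"
    using I unfolding IE_def by blast+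
  show "IE P \<subseteq> IE Q \<union> IE R \<union> edges_of zs"
  proof
    fix f assume f: "f \<in> IE P"
    then have fE: "f \<in> E" "open_edge f \<subseteq> inside (img P)" by (auto simp: IE_def)
    show "f \<in> IE Q \<union> IE R \<union> edges_of zs"
    proof (cases "f \<in> edges_of zs")
      case False
      moreover have "f \<notin> P" using f IE_disjoint by blast
      ultimately have "f \<notin> Q" "f \<notin> R" by (auto simp: P_def Q_def R_def)
      then have d: "open_edge f \<inter> img Q = {}" "open_edge f \<inter> img R = {}"
        using open_edge_img PE fE by blast+
      obtain x where x: "x \<in> open_edge f" using open_edge_nonempty[OF fE(1)] by blast
      have "x \<notin> img (edges_of zs)" using x d by (auto simp: Q_def img_Un)
      then have "x \<in> inside (img Q) \<or> x \<in> inside (img R)" using x fE I by blast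
      then have "open_edge f \<subseteq> inside (img Q) \<or> open_edge f \<subseteq> inside (img R)"
        using connected_subset_inside[OF connected_open_edge[OF fE(1)]] d x by blast
      then show ?thesis using fE by (auto simp: IE_def)
    qed simp
  qed
  define Z where "Z = set zs - {hd zs, last zs}"
  have hz: "hd zs = hd xs" "last zs = last xs" using ch by (auto simp: chordal_path_def)
  have zV: "set zs \<subseteq> V" using gpath_Union[OF p(3)] PE edge by blast
  have xV: "hd xs \<in> V" "last xs \<in> V" using zV hz gpath_ends[OF p(3)] by auto
  have "Z \<inter> IV Q = {}" "Z \<inter> IV R = {}"
    using vertex_inside_or_outside(2)[OF PE(2)] vertex_inside_or_outside(2)[OF PE(3)] gpath_Union[OF p(3)]
    by (auto simp: Z_def Q_def R_def)
  moreover have "IV Q \<inter> IV R = {}" using I by (auto simp: IV_def)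
  moreover have "IV Q \<union> IV R \<subseteq> IV P" using I by (auto simp: IV_def)
  moreover have "Z \<subseteq> IV P"
  proof
    fix v assume v: "v \<in> Z"
    then have vV: "v \<in> V" using zV by (auto simp: Z_def)
    then have "pos v \<in> img (edges_of zs)" using v pos_in_img[OF PE(4)] gpath_Union[OF p(3)] by (auto simp: Z_def)
    moreover have "pos v \<noteq> a" "pos v \<noteq> b"
      using v vV xV inj_onD[OF inj_pos, of v] hz unfolding cc(16,17) Z_def by auto
    ultimately show "v \<in> IV P" using I vV by (auto simp: IV_def)
  qed
  ultimately have "card (IV Q) + card (IV R) + card Z \<le> card (IV P)"
    by (subst card_Un_disjoint[symmetric], simp_all add: Z_def)+
      (auto intro!: card_mono simp: Int_Un_distrib Int_commute)
  moreover have "card Z = card (set zs) - card {hd zs, last zs}"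
    unfolding Z_def using gpath_ends[OF p(3)] by (intro card_Diff_subset) auto
  ultimately show "card (IV Q) + card (IV R) + card (set zs) \<le> card (IV P) + 2"
    using gpath_ends[OF p(3)] by simp
qed

text \<open>An outside path and one half of the cycle bound a region that swallows the old inside
  and the other half. This is what contradicts the choice of a cycle with the most edges
  inside.\<close>

lemma grow_inside:
  assumes ch: "chordal_path xs ys zs" and zs: "edges_of zs \<subseteq> OE (edges_of xs \<union> edges_of ys)"
  shows "gcycle xs zs \<and> IE (edges_of xs \<union> edges_of ys) \<union> edges_of ys \<subseteq> IE (edges_of xs \<union> edges_of zs) \<or>
         gcycle ys zs \<and> IE (edges_of xs \<union> edges_of ys) \<union> edges_of xs \<subseteq> IE (edges_of ys \<union> edges_of zs)"
proof -
  let ?P = "edges_of xs \<union> edges_of ys"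
  have dz: "edges_of zs \<inter> ?P = {}" using zs OE_disjoint by blast
  note c = chordal_path_gcycle[OF ch dz]
  have p: "gpath xs" "gpath ys" "gpath zs" using c by (auto simp: gcycle_def)
  have PE: "?P \<subseteq> E" "edges_of zs \<subseteq> E" using p by (auto simp: gpath_def)
  obtain c1 c2 c3 a b where cc: "arc c1" "pathstart c1 = a" "pathfinish c1 = b" "path_image c1 = img (edges_of xs)"
    "arc c2" "pathstart c2 = a" "pathfinish c2 = b" "path_image c2 = img (edges_of ys)"
    "arc c3" "pathstart c3 = a" "pathfinish c3 = b" "path_image c3 = img (edges_of zs)"
    "path_image c1 \<inter> path_image c2 = {a, b}" "path_image c1 \<inter> path_image c3 = {a, b}"
    "path_image c2 \<inter> path_image c3 = {a, b}"
    "a = pos (hd xs)" "b = pos (last xs)"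
    by (rule chordal_path_arcs[OF ch dz])
  have "img (edges_of zs) \<inter> inside (img ?P) = {}"
  proof -
    have "path_image (\<gamma> e) \<inter> inside (img ?P) = {}" if e: "e \<in> edges_of zs" for e
    proof -
      have "open_edge e \<inter> inside (img ?P) = {}"
        using zs e inside_Int_outside[of "img ?P"] unfolding OE_def by blast
      moreover have "pos v \<notin> inside (img ?P)" if "v \<in> e" for v
      proof -
        have vV: "v \<in> V" using that e PE edge by blast
        have "v \<in> \<Union>?P \<union> OV ?P" using OE_endpoints[OF PE(1)] zs e that by blast
        then have "v \<notin> IV ?P" using vertex_inside_or_outside(2,4)[OF PE(1)] by blast
        then show ?thesis using vV by (simp add: IV_def)
      qed
      ultimately show ?thesis unfolding open_edge_def by blast
    qed
    then show ?thesis unfolding img_def by blast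
  qed
  then have out: "path_image c3 \<inter> inside (path_image c1 \<union> path_image c2) = {}"
    by (simp add: cc img_Un)
  have ab: "a \<in> pos ` V" "b \<in> pos ` V"
    using gpath_ends[OF p(1)] gpath_Union[OF p(1)] PE edge unfolding cc(16,17) by blast+
  have oe: "open_edge e \<subseteq> img Q - {a, b}" if "e \<in> Q" "Q \<subseteq> E" for e Q
  proof -
    have "open_edge e \<inter> pos ` V = {}"
      using edge_vertices[of e] that unfolding open_edge_def by blast
    then show ?thesis using open_edge_in_img[OF that(1)] ab by blast
  qed
  show ?thesis
    using theta_inside[OF cc(1-3) cc(5-7) cc(9-11) cc(13-15) out] c oe PE
    unfolding cc(4,8,12) IE_def img_Un by blast
qed

end

section \<open>The number of edges of a planar graph\<close>

lemma edges_of_rotate: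
  assumes "as @ bs \<noteq> []"
  shows "edges_of (as @ bs @ [hd (as @ bs)]) = edges_of (bs @ as @ [hd (bs @ as)])"
proof (cases "as = [] \<or> bs = []")
  case True
  then show ?thesis by auto
next
  case False
  then obtain a as' b bs' where ab: "as = a # as'" "bs = b # bs'" by (meson neq_Nil_conv)
  have "edges_of ((a # as') @ b # (bs' @ [a])) = edges_of ((a # as') @ [b]) \<union> edges_of (b # bs' @ [a])"
    by (rule edges_of_append)
  moreover have "edges_of ((b # bs') @ a # (as' @ [b])) = edges_of ((b # bs') @ [a]) \<union> edges_of (a # as' @ [b])"
    by (rule edges_of_append)
  ultimately show ?thesis by (simp add: ab Un_commute)
qed

section \<open>Components and the edges they save\<close>

definition edge_rel :: "'a set set \<Rightarrow> ('a \<times> 'a) set" where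
  "edge_rel D = {(x, y). {x, y} \<in> D}"

lemma edge_rel_rtrancl_sym: "(x, y) \<in> (edge_rel D)\<^sup>* \<Longrightarrow> (y, x) \<in> (edge_rel D)\<^sup>*"
proof -
  have "sym (edge_rel D)" by (auto simp: sym_def edge_rel_def insert_commute)
  then show "(x, y) \<in> (edge_rel D)\<^sup>* \<Longrightarrow> (y, x) \<in> (edge_rel D)\<^sup>*"
    by (meson sym_rtrancl symD)
qed

lemma path_of_edge_rel:
  assumes "(u, v) \<in> (edge_rel D)\<^sup>*"
  shows "\<exists>xs. xs \<noteq> [] \<and> distinct xs \<and> hd xs = u \<and> last xs = v \<and> edges_of xs \<subseteq> D"
  using assms
proof (induction rule: rtrancl_induct)
  case base
  then show ?case by (intro exI[of _ "[u]"]) auto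
next
  case (step y z)
  then obtain xs where xs: "xs \<noteq> []" "distinct xs" "hd xs = u" "last xs = y" "edges_of xs \<subseteq> D" by blast
  have yz: "{y, z} \<in> D" using step by (auto simp: edge_rel_def)
  show ?case
  proof (cases "z \<in> set xs")
    case True
    then obtain as bs where ab: "xs = as @ z # bs" by (meson split_list)
    then have "edges_of (as @ [z]) \<subseteq> D" using xs(5) edges_of_append[of as z bs] by blast
    then show ?thesis using xs ab by (intro exI[of _ "as @ [z]"]) (cases as; auto)
  next
    case False
    obtain ws where ws: "xs = ws @ [y]" using xs by (metis append_butlast_last_id)
    have "edges_of (ws @ y # [z]) = edges_of (ws @ [y]) \<union> edges_of [y, z]" by (rule edges_of_append)
    then have "edges_of (xs @ [z]) \<subseteq> D" using ws xs(5) yz by auto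
    then show ?thesis using xs False by (intro exI[of _ "xs @ [z]"]) auto
  qed
qed

text \<open>A component on n vertices has at most 3n - 3 edges, so each of the pairwise disconnected
  vertices in \<open>T\<close> saves 3. The induction splits off the component of one of them; the
  bound is assumed for all subgraphs so that it passes to the rest.\<close>

lemma sparse_disconnected:
  fixes V :: "'a set" and E :: "'a set set"
  assumes "finite T" "finite V" "\<And>e. e \<in> E \<Longrightarrow> e \<subseteq> V \<and> card e = 2"
    and "\<And>V' E'. V' \<subseteq> V \<Longrightarrow> E' \<subseteq> E \<Longrightarrow> V' \<noteq> {} \<Longrightarrow> (\<forall>e\<in>E'. e \<subseteq> V') \<Longrightarrow> card E' + 3 \<le> 3 * card V'"
    and "T \<subseteq> V" "\<And>s t. s \<in> T \<Longrightarrow> t \<in> T \<Longrightarrow> s \<noteq> t \<Longrightarrow> (s, t) \<notin> (edge_rel E)\<^sup>*"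
  shows "card E + 3 * card T \<le> 3 * card V"
  using assms
proof (induction T arbitrary: V E rule: finite_induct)
  case empty
  show ?case
  proof (cases "V = {}")
    case True
    then have "E = {}" using empty(2) by fastforce
    then show ?thesis by simp
  next
    case False
    then show ?thesis using empty(3)[of V E] empty(2) by simp
  qed
next
  case (insert t T)
  define K where "K = {v \<in> V. (t, v) \<in> (edge_rel E)\<^sup>*}"
  define EK where "EK = {e \<in> E. e \<subseteq> K}"
  have finE: "finite E" by (rule finite_subset[of _ "Pow V"]) (use insert.prems in auto)
  have tK: "t \<in> K" using insert.prems by (auto simp: K_def)
  have KV: "K \<subseteq> V" by (auto simp: K_def)
  have rest: "e \<subseteq> V - K" if e: "e \<in> E - EK" for e
  proof -
    obtain x y where xy: "e = {x, y}" using insert.prems(2)[of e] e by (auto simp: card_2_iff)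
    then have r: "(x, y) \<in> edge_rel E" "(y, x) \<in> edge_rel E"
      using e by (auto simp: edge_rel_def insert_commute)
    have xyV: "x \<in> V" "y \<in> V" using insert.prems(2)[of e] e xy by auto
    have "x \<in> K \<longleftrightarrow> y \<in> K" using r xyV unfolding K_def by (auto intro: rtrancl_into_rtrancl)
    then show ?thesis using xyV e xy by (auto simp: EK_def)
  qed
  have "card EK + 3 \<le> 3 * card K"
    using tK KV by (intro insert.prems(3)) (auto simp: EK_def)
  moreover have "card (E - EK) + 3 * card T \<le> 3 * card (V - K)"
  proof (rule insert.IH)
    show "finite (V - K)" using insert.prems by simp
    show "e \<subseteq> V - K \<and> card e = 2" if "e \<in> E - EK" for e
      using rest[OF that] insert.prems(2)[of e] that by blast
    show "card E' + 3 \<le> 3 * card V'" if "V' \<subseteq> V - K" "E' \<subseteq> E - EK" "V' \<noteq> {}" "\<forall>e\<in>E'. e \<subseteq> V'" for V' E'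
      using that by (intro insert.prems(3)) auto
    show "T \<subseteq> V - K"
      using insert.prems(4,5) insert.hyps(2) by (auto simp: K_def)
    have "(edge_rel (E - EK))\<^sup>* \<subseteq> (edge_rel E)\<^sup>*"
      by (rule rtrancl_mono) (auto simp: edge_rel_def)
    then show "(s, u) \<notin> (edge_rel (E - EK))\<^sup>*" if "s \<in> T" "u \<in> T" "s \<noteq> u" for s u
      using insert.prems(5)[of s u] that by blast
  qed
  moreover have "card (E - EK) = card E - card EK" "card EK \<le> card E"
    using finE by (auto simp: EK_def intro!: card_Diff_subset card_mono)
  moreover have "card (V - K) = card V - card K" "card K \<le> card V"
    using insert.prems(1) KV by (auto intro!: card_Diff_subset card_mono finite_subset[OF KV])
  ultimately show ?case using insert.hyps by simp
qed

section \<open>Counting edges inside and outside a cycle\<close>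

context plane_graph
begin

lemma gcycle_card:
  assumes "gcycle xs ys"
  shows "card (set xs \<union> set ys) + 2 = length xs + length ys" "3 \<le> card (set xs \<union> set ys)"
proof -
  have p: "gpath xs" "gpath ys" and h: "hd xs = hd ys" "last xs = last ys"
    "set xs \<inter> set ys = {hd xs, last xs}" "edges_of xs \<inter> edges_of ys = {}"
    using assms by (auto simp: gcycle_def)
  have "card (set xs) = length xs" "card (set ys) = length ys"
    using p by (auto simp: gpath_def distinct_card)
  moreover have "card (set xs \<inter> set ys) = 2" using h(3) gpath_ends[OF p(1)] by simp
  ultimately show c: "card (set xs \<union> set ys) + 2 = length xs + length ys"
    using card_Un_Int[of "set xs" "set ys"] by simp
  show "3 \<le> card (set xs \<union> set ys)"
  proof (rule ccontr)
    assume "\<not> ?thesis"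
    then have "length xs = 2" "length ys = 2" using c p by (auto simp: gpath_def)
    then obtain a b a' b' where ab: "xs = [a, b]" "ys = [a', b']"
      by (auto simp: numeral_2_eq_2 length_Suc_conv)
    then show False using h by simp
  qed
qed

lemma gcycle_Union:
  assumes "gcycle xs ys"
  shows "\<Union>(edges_of xs \<union> edges_of ys) = set xs \<union> set ys"
  using assms gpath_Union by (auto simp: gcycle_def)

text \<open>A connecting path may end anywhere on the cycle, whereas the theta curve needs the cycle
  cut exactly at these two vertices.\<close>

lemma gcycle_at:
  assumes cyc: "gcycle xs ys" and pq: "p \<in> set xs \<union> set ys" "q \<in> set xs \<union> set ys" "p \<noteq> q"
  shows "\<exists>xs' ys'. gcycle xs' ys' \<and> hd xs' = p \<and> last xs' = q \<and>
    edges_of xs' \<union> edges_of ys' = edges_of xs \<union> edges_of ys"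
proof -
  have p: "gpath xs" "gpath ys" and h: "hd xs = hd ys" "last xs = last ys"
    "set xs \<inter> set ys = {hd xs, last xs}" "edges_of xs \<inter> edges_of ys = {}"
    using cyc by (auto simp: gcycle_def)
  have dist: "distinct xs" "distinct ys" and len: "2 \<le> length xs" "2 \<le> length ys"
    using p by (auto simp: gpath_def)
  obtain b xs0 where xs: "xs = xs0 @ [b]" using len by (cases xs rule: rev_cases) auto
  obtain a ys0 where ys: "ys = a # ys0" using len by (cases ys) auto
  have ne: "xs0 \<noteq> []" "ys0 \<noteq> []" using len xs ys by auto
  have hda: "hd xs0 = a" "last ys0 = b" using h xs ys ne by auto
  obtain zs0 where zs0: "rev ys0 = b # zs0" using hda ne by (metis hd_rev list.collapse rev_is_Nil_conv)
  \<comment> \<open>A tour of the cycle with each vertex once: \<open>xs\<close> without its last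
    vertex, then \<open>ys\<close> backwards without its first. It is rotated to start at
    \<open>p\<close> and then cut at \<open>q\<close>.\<close>
  define cs where "cs = xs0 @ rev ys0"
  have hdc: "hd cs = a" using hda ne by (simp add: cs_def)
  have dcs: "distinct cs"
  proof -
    have "set xs0 \<inter> set ys0 \<subseteq> {a, b}" using h(3) xs ys hda ne by auto
    moreover have "b \<notin> set xs0" "a \<notin> set ys0" using dist xs ys by auto
    ultimately show ?thesis using dist xs ys by (auto simp: cs_def)
  qed
  have scs: "set cs = set xs \<union> set ys"
  proof -
    have "a \<in> set xs0" "b \<in> set ys0" using hda ne hd_in_set last_in_set by metis+
    then show ?thesis by (auto simp: cs_def xs ys)
  qed
  have "edges_of (xs0 @ b # (zs0 @ [a])) = edges_of (xs0 @ [b]) \<union> edges_of (b # zs0 @ [a])"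
    by (rule edges_of_append)
  moreover have "b # zs0 @ [a] = rev ys" by (simp add: ys zs0)
  ultimately have ecs: "edges_of (cs @ [hd cs]) = edges_of xs \<union> edges_of ys"
    unfolding hdc by (simp add: cs_def zs0 xs)
  obtain as bs where ab: "cs = as @ p # bs" using pq scs by (metis split_list)
  define ds where "ds = bs @ as"
  have "q \<in> set ds" using pq scs ab by (auto simp: ds_def)
  then obtain es fs where ef: "ds = es @ q # fs" by (meson split_list)
  have dd: "distinct (p # es @ q # fs)" using dcs ab ef[symmetric] by (auto simp: ds_def)
  define xs' where "xs' = p # es @ [q]"
  define ys' where "ys' = p # rev fs @ [q]"
  have E': "edges_of xs' \<union> edges_of ys' = edges_of xs \<union> edges_of ys"
  proof -
    have "edges_of xs \<union> edges_of ys = edges_of (as @ (p # bs) @ [hd (as @ (p # bs))])"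
      using ecs by (simp add: ab)
    also have "\<dots> = edges_of ((p # bs) @ as @ [hd ((p # bs) @ as)])"
      by (rule edges_of_rotate) simp
    also have "(p # bs) @ as @ [hd ((p # bs) @ as)] = p # ds @ [p]" by (simp add: ds_def)
    also have "\<dots> = (p # es) @ q # (fs @ [p])" by (simp add: ef)
    also have "edges_of \<dots> = edges_of ((p # es) @ [q]) \<union> edges_of (q # fs @ [p])" by (rule edges_of_append)
    also have "edges_of (q # fs @ [p]) = edges_of (rev ys')" by (simp add: ys'_def)
    finally show ?thesis by (simp add: xs'_def)
  qed
  have gp: "gpath xs'" "gpath ys'"
    using dd E' p unfolding gpath_def by (auto simp: xs'_def ys'_def)
  \<comment> \<open>A common edge could only be {p, q}; then both paths would consist of it, but a
    cycle has at least three vertices.\<close>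
  have "edges_of xs' \<inter> edges_of ys' = {}"
  proof (rule ccontr)
    assume "\<not> ?thesis"
    then obtain e where e: "e \<in> edges_of xs'" "e \<in> edges_of ys'" by blast
    then have "e \<subseteq> set xs' \<inter> set ys'" using edges_of_subset by fast
    also have "\<dots> = {p, q}" using dd by (auto simp: xs'_def ys'_def)
    finally have "e = {p, q}"
      using edge[of e] e gp pq by (intro card_subset_eq) (auto simp: gpath_def)
    then have "length xs' = 2" "length ys' = 2"
      using edges_of_ends[of xs'] edges_of_ends[of ys'] e gp by (auto simp: gpath_def xs'_def ys'_def)
    then have "set ds = {q}" using ef by (auto simp: xs'_def ys'_def)
    then have "set cs = {p, q}" using ab by (auto simp: ds_def)
    then show False using gcycle_card(2)[OF cyc] scs pq(3) by simp
  qed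
  then have "gcycle xs' ys'"
    using gp dd by (auto simp: gcycle_def xs'_def ys'_def)
  then show ?thesis using E' by (intro exI[of _ xs'] exI[of _ ys']) (simp add: xs'_def)
qed

text \<open>Meant for either side of the cycle, with \<open>D\<close> the edges and \<open>W\<close>
  the vertices there. Since the cycle has edges of its own, \<open>D\<close> is a proper subset of
  \<open>E\<close>, so \<open>hyp\<close>, the induction hypothesis of the edge bound, applies to
  it.\<close>

lemma chord_or_sparse:
  assumes hyp: "\<And>V' E'. V' \<subseteq> V \<Longrightarrow> E' \<subset> E \<Longrightarrow> V' \<noteq> {} \<Longrightarrow> (\<forall>e\<in>E'. e \<subseteq> V') \<Longrightarrow> card E' + 3 \<le> 3 * card V'"
    and cyc: "gcycle xs ys"
    and D: "D \<subseteq> E" "D \<inter> (edges_of xs \<union> edges_of ys) = {}" "\<And>e. e \<in> D \<Longrightarrow> e \<subseteq> set xs \<union> set ys \<union> W"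
    and W: "W \<subseteq> V" "W \<inter> (set xs \<union> set ys) = {}"
  shows "card D \<le> 3 * card W \<or>
    (\<exists>xs' ys' zs. chordal_path xs' ys' zs \<and> edges_of zs \<subseteq> D \<and> edges_of xs' \<union> edges_of ys' = edges_of xs \<union> edges_of ys)"
proof -
  let ?S = "set xs \<union> set ys"
  let ?Q = "\<lambda>zs. zs \<noteq> [] \<and> distinct zs \<and> edges_of zs \<subseteq> D \<and> hd zs \<in> ?S \<and> last zs \<in> ?S \<and> hd zs \<noteq> last zs"
  have p: "gpath xs" "gpath ys" using cyc by (auto simp: gcycle_def)
  have SV: "?S \<subseteq> V" using gpath_Union[OF p(1)] gpath_Union[OF p(2)] p edge unfolding gpath_def by blast
  show ?thesis
  proof (cases "\<exists>zs. ?Q zs")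
    case True
    \<comment> \<open>A shortest path between two cycle vertices meets the cycle at its ends
      only.\<close>
    then obtain zs where zs: "?Q zs" "\<And>ws. ?Q ws \<Longrightarrow> length zs \<le> length ws"
      using ex_has_least_nat[of ?Q _ length] by blast
    have "set zs \<inter> ?S \<subseteq> {hd zs, last zs}"
    proof
      fix z assume z: "z \<in> set zs \<inter> ?S"
      show "z \<in> {hd zs, last zs}"
      proof (rule ccontr)
        assume nz: "z \<notin> {hd zs, last zs}"
        obtain as bs where ab: "zs = as @ z # bs" using z by (meson IntD1 split_list)
        have ne: "as \<noteq> []" "bs \<noteq> []" using nz ab by auto
        have "edges_of (as @ [z]) \<subseteq> D" using zs(1) edges_of_append[of as z bs] ab by blast
        then have "?Q (as @ [z])" using zs(1) ab z nz ne by auto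
        then have "length zs \<le> length (as @ [z])" by (rule zs(2))
        then show False using ab ne by simp
      qed
    qed
    then have zS: "set zs \<inter> ?S = {hd zs, last zs}" using zs(1) by auto
    obtain xs' ys' where c: "gcycle xs' ys'" "hd xs' = hd zs" "last xs' = last zs"
      "edges_of xs' \<union> edges_of ys' = edges_of xs \<union> edges_of ys"
      using gcycle_at[OF cyc, of "hd zs" "last zs"] zs(1) by blast
    have "set xs' \<union> set ys' = ?S" using gcycle_Union[OF c(1)] gcycle_Union[OF cyc] c(4) by simp
    moreover have "2 \<le> length zs"
      using zs(1) by (cases zs rule: edges_of.cases) auto
    ultimately have "chordal_path xs' ys' zs"
      unfolding chordal_path_def gpath_def using c zS zs(1) D(1) by auto
    then show ?thesis using zs(1) c(4) by blast
  next
    case False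
    have fin: "finite W" using W(1) finite_V finite_subset by blast
    have "hd xs \<in> \<Union>(edges_of xs)" using gpath_Union[OF p(1)] gpath_ends[OF p(1)] by simp
    then obtain e where "e \<in> edges_of xs" by blast
    then have DE: "D \<subset> E" using D(1,2) p(1) unfolding gpath_def by blast
    \<comment> \<open>Without a connecting path the cycle vertices are pairwise disconnected, and
      the 3 that each saves cancels its own share of the right-hand side.\<close>
    have "card D + 3 * card ?S \<le> 3 * card (?S \<union> W)"
    proof (rule sparse_disconnected)
      show "e \<subseteq> ?S \<union> W \<and> card e = 2" if "e \<in> D" for e
        using D(1) D(3)[OF that] edge that by blast
      show "card E' + 3 \<le> 3 * card V'" if "V' \<subseteq> ?S \<union> W" "E' \<subseteq> D" "V' \<noteq> {}" "\<forall>e\<in>E'. e \<subseteq> V'" for V' E'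
        using that DE SV W(1) by (intro hyp) blast+
      show "(s, t) \<notin> (edge_rel D)\<^sup>*" if "s \<in> ?S" "t \<in> ?S" "s \<noteq> t" for s t
        using path_of_edge_rel[of s t D] False that by blast
    qed (use fin in auto)
    also have "card (?S \<union> W) = card ?S + card W"
      using W(2) fin by (intro card_Un_disjoint) auto
    finally show ?thesis by simp
  qed
qed

lemma inside_bound:
  assumes hyp: "\<And>V' E'. V' \<subseteq> V \<Longrightarrow> E' \<subset> E \<Longrightarrow> V' \<noteq> {} \<Longrightarrow> (\<forall>e\<in>E'. e \<subseteq> V') \<Longrightarrow> card E' + 3 \<le> 3 * card V'"
    and "gcycle xs ys"
  shows "card (IE (edges_of xs \<union> edges_of ys)) + 3
    \<le> 3 * card (IV (edges_of xs \<union> edges_of ys)) + card (set xs \<union> set ys)"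
  using assms(2)
proof (induction "card (IE (edges_of xs \<union> edges_of ys))" arbitrary: xs ys rule: less_induct)
  case less
  let ?P = "edges_of xs \<union> edges_of ys"
  have PE: "?P \<subseteq> E" using less.prems by (auto simp: gcycle_def gpath_def)
  have U: "\<Union>?P = set xs \<union> set ys" using gcycle_Union[OF less.prems] .
  have "card (IE ?P) \<le> 3 * card (IV ?P) \<or>
    (\<exists>xs' ys' zs. chordal_path xs' ys' zs \<and> edges_of zs \<subseteq> IE ?P \<and> edges_of xs' \<union> edges_of ys' = ?P)"
    by (rule chord_or_sparse[OF hyp less.prems])
      (use IE_disjoint[of ?P] IE_endpoints[OF PE] vertex_inside_or_outside(2)[OF PE] U in \<open>auto simp: IE_def IV_def\<close>)
  then show ?case
  proof
    assume "card (IE ?P) \<le> 3 * card (IV ?P)"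
    then show ?thesis using gcycle_card(2)[OF less.prems] by simp
  next
    assume "\<exists>xs' ys' zs. chordal_path xs' ys' zs \<and> edges_of zs \<subseteq> IE ?P \<and> edges_of xs' \<union> edges_of ys' = ?P"
    then obtain xs' ys' zs where ch: "chordal_path xs' ys' zs" and P: "?P = edges_of xs' \<union> edges_of ys'"
      and zs: "edges_of zs \<subseteq> IE (edges_of xs' \<union> edges_of ys')" by metis
    note sp = split_inside[OF ch zs]
    have g: "gcycle xs' ys'" "gpath zs" using ch by (auto simp: chordal_path_def)
    have "hd zs \<in> \<Union>(edges_of zs)" using gpath_Union[OF g(2)] gpath_ends[OF g(2)] by simp
    then have ne: "edges_of zs \<noteq> {}" by blast
    let ?Q = "edges_of xs' \<union> edges_of zs" and ?R = "edges_of ys' \<union> edges_of zs"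
    have "IE ?Q \<subset> IE ?P" "IE ?R \<subset> IE ?P" using sp(3,4) ne zs unfolding P by blast+
    then have "card (IE ?Q) < card (IE ?P)" "card (IE ?R) < card (IE ?P)"
      by (auto intro: psubset_card_mono)
    then have b: "card (IE ?Q) + 3 \<le> 3 * card (IV ?Q) + card (set xs' \<union> set zs)"
      "card (IE ?R) + 3 \<le> 3 * card (IV ?R) + card (set ys' \<union> set zs)"
      using less.hyps sp(1,2) by blast+
    have "card (IE ?P) \<le> card (IE ?Q \<union> IE ?R \<union> edges_of zs)"
      unfolding P using sp(5) by (intro card_mono) auto
    also have "\<dots> \<le> card (IE ?Q) + card (IE ?R) + card (edges_of zs)"
      by (meson card_Un_le add_le_mono1 le_trans)
    also have "card (edges_of zs) \<le> length zs - 1" by (rule card_edges_of)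
    finally have c: "card (IE ?P) \<le> card (IE ?Q) + card (IE ?R) + (length zs - 1)" by simp
    have lz: "card (set zs) = length zs" "2 \<le> length zs" using g(2) by (auto simp: gpath_def distinct_card)
    have U': "set xs \<union> set ys = set xs' \<union> set ys'" using U gcycle_Union[OF g(1)] P by simp
    \<comment> \<open>Let l be the length of the old cycle and t the number of vertices of
      \<open>zs\<close>. The path has at most t - 1 edges, takes t - 2 vertices from the inside, and
      the new cycle lengths add up to l + 2t - 2. With these numbers the two bounds add up to
      exactly the claimed one.\<close>
    show ?thesis
      using b c sp(6) lz gcycle_card(1)[OF sp(1)] gcycle_card(1)[OF sp(2)] gcycle_card(1)[OF g(1)]
      unfolding U' P by linarith
  qed
qed

lemma sparse_step:
  assumes hyp: "\<And>V' E'. V' \<subseteq> V \<Longrightarrow> E' \<subset> E \<Longrightarrow> V' \<noteq> {} \<Longrightarrow> (\<forall>e\<in>E'. e \<subseteq> V') \<Longrightarrow> card E' + 3 \<le> 3 * card V'"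
    and "V \<noteq> {}"
  shows "card E + 3 \<le> 3 * card V"
proof (cases "\<exists>xs ys. gcycle xs ys")
  case False
  show ?thesis
  proof (cases "E = {}")
    case True
    then show ?thesis using assms(2) finite_V by (simp add: Suc_leI card_gt_0_iff)
  next
    case ne: False
    then obtain e where e: "e \<in> E" by blast
    have "card e = 2" using edge[OF e] by simp
    then obtain u v where uv: "e = {u, v}" "u \<noteq> v" by (auto simp: card_2_iff)
    \<comment> \<open>Another path between the ends of \<open>e\<close> would form a cycle with
      \<open>e\<close>.\<close>
    have no: "(u, v) \<notin> (edge_rel (E - {e}))\<^sup>*"
    proof
      assume "(u, v) \<in> (edge_rel (E - {e}))\<^sup>*"
      from path_of_edge_rel[OF this] obtain xs
        where xs: "xs \<noteq> []" "distinct xs" "hd xs = u" "last xs = v" "edges_of xs \<subseteq> E - {e}"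
        by blast
      then have "2 \<le> length xs" using uv by (cases xs rule: edges_of.cases) auto
      moreover have "u \<in> set xs" "v \<in> set xs" using xs by auto
      ultimately have "gcycle xs [u, v]"
        unfolding gcycle_def gpath_def using xs uv e by auto
      then show False using False by blast
    qed
    have "card (E - {e}) + 3 * card {u, v} \<le> 3 * card V"
    proof (rule sparse_disconnected)
      show "card E' + 3 \<le> 3 * card V'" if "V' \<subseteq> V" "E' \<subseteq> E - {e}" "V' \<noteq> {}" "\<forall>e\<in>E'. e \<subseteq> V'" for V' E'
        using that e by (intro hyp) blast+
      show "(s, t) \<notin> (edge_rel (E - {e}))\<^sup>*" if "s \<in> {u, v}" "t \<in> {u, v}" "s \<noteq> t" for s t
        using no edge_rel_rtrancl_sym[of v u "E - {e}"] that by auto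
    qed (use edge finite_V e uv in auto)
    then show ?thesis using uv e finite_E by simp
  qed
next
  case True
  let ?Q = "\<lambda>(xs, ys). gcycle xs ys"
  let ?m = "\<lambda>(xs, ys). card (IE (edges_of xs \<union> edges_of ys))"
  have "\<forall>y. ?Q y \<longrightarrow> ?m y < Suc (card E)"
    using finite_E by (auto intro!: card_mono le_imp_less_Suc simp: IE_def)
  moreover obtain xy0 where "?Q xy0" using True by auto
  ultimately obtain xy where "?Q xy" "\<forall>y. ?Q y \<longrightarrow> ?m y \<le> ?m xy"
    using ex_has_greatest_nat[of ?Q xy0 ?m "Suc (card E)"] by blast
  then obtain xs ys where cyc: "gcycle xs ys" and max: "\<And>xs' ys'. gcycle xs' ys' \<Longrightarrow>
      card (IE (edges_of xs' \<union> edges_of ys')) \<le> card (IE (edges_of xs \<union> edges_of ys))"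
    by (cases xy) auto
  let ?P = "edges_of xs \<union> edges_of ys"
  have PE: "?P \<subseteq> E" using cyc by (auto simp: gcycle_def gpath_def)
  have U: "\<Union>?P = set xs \<union> set ys" using gcycle_Union[OF cyc] .
  have "card (OE ?P) \<le> 3 * card (OV ?P) \<or>
    (\<exists>xs' ys' zs. chordal_path xs' ys' zs \<and> edges_of zs \<subseteq> OE ?P \<and> edges_of xs' \<union> edges_of ys' = ?P)"
    by (rule chord_or_sparse[OF hyp cyc])
      (use OE_disjoint[of ?P] OE_endpoints[OF PE] vertex_inside_or_outside(3)[OF PE] U in \<open>auto simp: OE_def OV_def\<close>)
  moreover have "\<not> (\<exists>xs' ys' zs. chordal_path xs' ys' zs \<and> edges_of zs \<subseteq> OE ?P \<and> edges_of xs' \<union> edges_of ys' = ?P)"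
  proof
    assume "\<exists>xs' ys' zs. chordal_path xs' ys' zs \<and> edges_of zs \<subseteq> OE ?P \<and> edges_of xs' \<union> edges_of ys' = ?P"
    then obtain xs' ys' zs where ch: "chordal_path xs' ys' zs" and P: "?P = edges_of xs' \<union> edges_of ys'"
      and zs: "edges_of zs \<subseteq> OE (edges_of xs' \<union> edges_of ys')" by metis
    have g: "gpath xs'" "gpath ys'" using ch by (auto simp: chordal_path_def gcycle_def)
    have ne: "edges_of ws \<noteq> {}" if "gpath ws" for ws
    proof -
      have "hd ws \<in> \<Union>(edges_of ws)" using gpath_Union[OF that] gpath_ends[OF that] by simp
      then show ?thesis by blast
    qed
    obtain xs1 ys1 ws where "gcycle xs1 ys1" and ws: "gpath ws" "edges_of ws \<subseteq> ?P"
      "IE ?P \<union> edges_of ws \<subseteq> IE (edges_of xs1 \<union> edges_of ys1)"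
      using grow_inside[OF ch zs] g unfolding P by blast
    then have "card (IE (edges_of xs1 \<union> edges_of ys1)) \<le> card (IE ?P)" using max by blast
    moreover have "IE ?P \<subset> IE (edges_of xs1 \<union> edges_of ys1)"
      using ws(2,3) ne[OF ws(1)] IE_disjoint[of ?P] by blast
    then have "card (IE ?P) < card (IE (edges_of xs1 \<union> edges_of ys1))" by (intro psubset_card_mono) auto
    ultimately show False by simp
  qed
  ultimately have O: "card (OE ?P) \<le> 3 * card (OV ?P)" by blast
  have I: "card (IE ?P) + 3 \<le> 3 * card (IV ?P) + card (set xs \<union> set ys)"
    by (rule inside_bound[OF hyp cyc])
  have "card E \<le> card (?P \<union> IE ?P \<union> OE ?P)"
    using edge_inside_or_outside[OF PE] by (intro card_mono) auto
  also have "\<dots> \<le> card (edges_of xs) + card (edges_of ys) + card (IE ?P) + card (OE ?P)"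
    by (meson card_Un_le add_le_mono1 le_trans)
  finally have E: "card E \<le> card (edges_of xs) + card (edges_of ys) + card (IE ?P) + card (OE ?P)" .
  have "card V = card (\<Union>?P \<union> IV ?P \<union> OV ?P)"
    using vertex_inside_or_outside(1)[OF PE] by simp
  also have "\<dots> = card (\<Union>?P \<union> IV ?P) + card (OV ?P)"
    using vertex_inside_or_outside(3,4)[OF PE] unfolding U by (intro card_Un_disjoint) auto
  also have "card (\<Union>?P \<union> IV ?P) = card (\<Union>?P) + card (IV ?P)"
    using vertex_inside_or_outside(2)[OF PE] unfolding U by (intro card_Un_disjoint) auto
  finally have V: "card V = card (set xs \<union> set ys) + card (IV ?P) + card (OV ?P)" unfolding U .
  \<comment> \<open>For cycle length l, n vertices inside and m outside, there are at most l + (3n +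
    l - 3) + 3m edges, which is 3|V| - l - 3. The lengths of at least 2 keep the subtraction in
    \<open>card_edges_of\<close> from being truncated.\<close>
  have "2 \<le> length xs" "2 \<le> length ys" using cyc by (auto simp: gcycle_def gpath_def)
  then show ?thesis
    using E V I O gcycle_card[OF cyc] card_edges_of[of xs] card_edges_of[of ys] by linarith
qed

end

section \<open>The edge bound for planar graphs\<close>

lemma plane_graph_subgraph:
  assumes "plane_graph V E pos \<gamma>" "V' \<subseteq> V" "E' \<subseteq> E" "\<forall>e\<in>E'. e \<subseteq> V'"
  shows "plane_graph V' E' pos \<gamma>"
proof -
  interpret plane_graph V E pos \<gamma> by fact
  show ?thesis
  proof
    show "finite V'" using finite_V assms(2) finite_subset by blast
    show "inj_on pos V'" using inj_pos assms(2) inj_on_subset by blast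
    show "path_image (\<gamma> e) \<inter> pos ` V' = pos ` e" if "e \<in> E'" for e
      using edge_vertices[of e] assms that by blast
    show "e \<subseteq> V' \<and> card e = 2" if "e \<in> E'" for e using edge assms that by blast
    show "path_image (\<gamma> e) \<inter> path_image (\<gamma> e') \<subseteq> pos ` (e \<inter> e')" if "e \<in> E'" "e' \<in> E'" "e \<noteq> e'" for e e'
      using edge_cross assms(3) that by blast
  qed (use arc_edge ends_edge assms(3) in blast)+
qed

text \<open>Unlike Euler's 3|V| - 6, the bound 3|V| - 3 holds for one and two vertices too, so the
  induction can apply it to every component that is split off.\<close>

theorem plane_graph_sparse:
  assumes "plane_graph V E pos \<gamma>" "V \<noteq> {}"
  shows "card E + 3 \<le> 3 * card V"
  using assms
proof (induction "card E" arbitrary: V E rule: less_induct)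
  case less
  interpret plane_graph V E pos \<gamma> by (rule less.prems)
  show ?case
  proof (rule sparse_step)
    fix V' E' assume "V' \<subseteq> V" "E' \<subset> E" "V' \<noteq> {}" "\<forall>e\<in>E'. e \<subseteq> V'"
    then show "card E' + 3 \<le> 3 * card V'"
      using less.hyps[of E' V'] plane_graph_subgraph[OF less.prems(1), of V' E'] finite_E
      by (simp add: psubset_card_mono psubset_imp_subset)
  qed (rule less.prems)
qed

text \<open>The drawing is moved from \<open>real^2\<close> to the complex plane, where winding
  numbers are available.\<close>

lemma planar_imp_plane_graph:
  assumes "simple_graph V E" "planar V E"
  shows "\<exists>pos \<gamma>. plane_graph V E pos \<gamma>"
proof -
  obtain p :: "'a \<Rightarrow> real^2" and g :: "'a set \<Rightarrow> real \<Rightarrow> real^2" where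
    pg: "inj_on p V \<and>
        (\<forall>e\<in>E. arc (g e) \<and> {pathstart (g e), pathfinish (g e)} = p ` e
               \<and> path_image (g e) \<inter> p ` V = p ` e) \<and>
        (\<forall>e\<in>E. \<forall>e'\<in>E. e \<noteq> e' \<longrightarrow> path_image (g e) \<inter> path_image (g e') \<subseteq> p ` (e \<inter> e'))"
    using assms(2) unfolding planar_def by (elim exE) (rule that)
  then have p: "inj_on p V" and
    g: "\<And>e. e \<in> E \<Longrightarrow> arc (g e)" "\<And>e. e \<in> E \<Longrightarrow> {pathstart (g e), pathfinish (g e)} = p ` e"
      "\<And>e. e \<in> E \<Longrightarrow> path_image (g e) \<inter> p ` V = p ` e"
      "\<And>e e'. e \<in> E \<Longrightarrow> e' \<in> E \<Longrightarrow> e \<noteq> e' \<Longrightarrow> path_image (g e) \<inter> path_image (g e') \<subseteq> p ` (e \<inter> e')"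
    by simp_all
  define h where "h x = Complex (x $ 1) (x $ 2)" for x :: "real^2"
  have inj: "inj h" by (auto simp: inj_on_def h_def vec_eq_iff forall_2)
  have cont: "continuous_on S h" for S
    unfolding h_def Complex_eq by (intro continuous_intros)
  have "plane_graph V E (h \<circ> p) (\<lambda>e. h \<circ> g e)"
  proof
    show "finite V" using assms(1) by (simp add: simple_graph_def)
    show "e \<subseteq> V \<and> card e = 2" if "e \<in> E" for e using assms(1) that by (simp add: simple_graph_def)
    show "inj_on (h \<circ> p) V" by (rule comp_inj_on[OF p inj_on_subset[OF inj]]) simp
    fix e assume e: "e \<in> E"
    show "arc (h \<circ> g e)"
      using g(1)[OF e] inj cont continuous_on_compose[of "{0..1}" "g e" h]
      unfolding arc_def path_def by (auto intro!: comp_inj_on intro: inj_on_subset)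
    have "{pathstart (h \<circ> g e), pathfinish (h \<circ> g e)} = h ` {pathstart (g e), pathfinish (g e)}"
      by (simp add: pathstart_def pathfinish_def)
    then show "{pathstart (h \<circ> g e), pathfinish (h \<circ> g e)} = (h \<circ> p) ` e"
      unfolding g(2)[OF e] by (simp add: image_comp)
    show "path_image (h \<circ> g e) \<inter> (h \<circ> p) ` V = (h \<circ> p) ` e"
      using g(3)[OF e] image_Int[OF inj, of "path_image (g e)" "p ` V"]
      by (simp add: path_image_compose image_comp)
    fix e' assume e': "e' \<in> E" "e \<noteq> e'"
    have "h ` (path_image (g e) \<inter> path_image (g e')) \<subseteq> h ` p ` (e \<inter> e')"
      using g(4)[OF e e'] by (rule image_mono)
    then show "path_image (h \<circ> g e) \<inter> path_image (h \<circ> g e') \<subseteq> (h \<circ> p) ` (e \<inter> e')"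
      using image_Int[OF inj, of "path_image (g e)" "path_image (g e')"]
      by (simp add: path_image_compose image_comp)
  qed
  then show ?thesis by blast
qed

theorem planar_sparse:
  assumes "simple_graph V E" "planar V E" "V' \<subseteq> V" "E' \<subseteq> E" "\<forall>e\<in>E'. e \<subseteq> V'" "V' \<noteq> {}"
  shows "card E' + 3 \<le> 3 * card V'"
proof -
  obtain pos \<gamma> where "plane_graph V E pos \<gamma>" using planar_imp_plane_graph[OF assms(1,2)] by blast
  then show ?thesis using plane_graph_sparse plane_graph_subgraph assms(3-6) by blast
qed

section \<open>Reducible configurations\<close>

lemma exists_color:
  assumes "finite A" "card A \<le> D"
  shows "\<exists>x\<in>{1..D + 1}. x \<notin> (A :: nat set)"
proof (rule ccontr)
  assume "\<not> ?thesis"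
  then have "card {1..D + 1} \<le> card A" by (intro card_mono assms(1)) auto
  then show False using assms(2) by simp
qed

section \<open>Partial total colourings and precoloured graphs\<close>

definition neighbors :: "'a set set \<Rightarrow> 'a \<Rightarrow> 'a set" where
  "neighbors E v = {u. {v, u} \<in> E}"

lemma total_coloringD:
  assumes "total_coloring V E k cv ce"
  shows "v \<in> V \<Longrightarrow> cv v \<in> {1..k}" "e \<in> E \<Longrightarrow> ce e \<in> {1..k}"
    "u \<in> V \<Longrightarrow> v \<in> V \<Longrightarrow> {u, v} \<in> E \<Longrightarrow> cv u \<noteq> cv v"
    "e \<in> E \<Longrightarrow> e' \<in> E \<Longrightarrow> e \<noteq> e' \<Longrightarrow> e \<inter> e' \<noteq> {} \<Longrightarrow> ce e \<noteq> ce e'"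
    "e \<in> E \<Longrightarrow> v \<in> e \<Longrightarrow> ce e \<noteq> cv v"
  using assms unfolding total_coloring_def by simp_all

text \<open>All edges are coloured; \<open>S\<close> holds the vertices still to be coloured, where
  the values of \<open>cv\<close> are ignored.\<close>

definition partial_total_coloring ::
  "'a set \<Rightarrow> 'a set set \<Rightarrow> 'a set \<Rightarrow> nat \<Rightarrow> ('a \<Rightarrow> nat) \<Rightarrow> ('a set \<Rightarrow> nat) \<Rightarrow> bool" where
  "partial_total_coloring V E S k cv ce \<longleftrightarrow>
     (\<forall>v\<in>V - S. cv v \<in> {1..k}) \<and> (\<forall>e\<in>E. ce e \<in> {1..k}) \<and>
     (\<forall>u\<in>V - S. \<forall>v\<in>V - S. {u, v} \<in> E \<longrightarrow> cv u \<noteq> cv v) \<and>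
     (\<forall>e\<in>E. \<forall>e'\<in>E. e \<noteq> e' \<and> e \<inter> e' \<noteq> {} \<longrightarrow> ce e \<noteq> ce e') \<and>
     (\<forall>e\<in>E. \<forall>v\<in>e - S. ce e \<noteq> cv v)"

lemma partial_total_coloring_empty:
  "partial_total_coloring V E {} k cv ce \<longleftrightarrow> total_coloring V E k cv ce"
  by (simp add: partial_total_coloring_def total_coloring_def)

text \<open>The sets \<open>B v\<close> contain forbidden vertex colours. They keep an uncoloured vertex away from the
  colours of its precoloured neighbours even after the edges between them have been deleted.\<close>

definition extendable ::
  "'a set \<Rightarrow> 'a set set \<Rightarrow> ('a \<Rightarrow> nat) \<Rightarrow> ('a set \<Rightarrow> nat) \<Rightarrow> ('a \<Rightarrow> nat set) \<Rightarrow> nat \<Rightarrow> 'a set \<Rightarrow> 'a set set \<Rightarrow> bool" where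
  "extendable VH EH cvH ceH B k V E \<longleftrightarrow> (\<exists>cv ce. total_coloring V E k cv ce \<and>
     (\<forall>v\<in>V. cv v \<notin> B v) \<and> (\<forall>v\<in>VH. cv v = cvH v) \<and> (\<forall>e\<in>EH. ce e = ceH e))"

lemma simple_graph_finite: "simple_graph V E \<Longrightarrow> finite E"
  unfolding simple_graph_def by (intro finite_subset[of E "Pow V"]) auto

lemma simple_graph_edge:
  assumes "simple_graph V E" "{u, v} \<in> E"
  shows "u \<noteq> v" "u \<in> V" "v \<in> V"
proof -
  have "{u, v} \<subseteq> V \<and> card {u, v} = 2"
    using assms unfolding simple_graph_def by (elim conjE) (rule bspec)
  then show "u \<noteq> v" "u \<in> V" "v \<in> V" by (auto simp: card_insert_if)
qed

lemma simple_graph_edgeE: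
  assumes "simple_graph V E" "e \<in> E" "v \<in> e"
  obtains u where "e = {v, u}" "u \<noteq> v"
proof -
  have "card e = 2" using assms by (simp add: simple_graph_def)
  then obtain a b where "e = {a, b}" "a \<noteq> b" by (auto simp: card_2_iff)
  then show thesis using that[of a] that[of b] assms(3) by auto
qed

lemma card_neighbors:
  assumes "simple_graph V E"
  shows "finite (neighbors E v)" "card (neighbors E v) = degree E v"
proof -
  have "(\<lambda>u. {v, u}) ` neighbors E v = {e \<in> E. v \<in> e}"
  proof
    show "(\<lambda>u. {v, u}) ` neighbors E v \<subseteq> {e \<in> E. v \<in> e}" by (auto simp: neighbors_def)
    show "{e \<in> E. v \<in> e} \<subseteq> (\<lambda>u. {v, u}) ` neighbors E v"
    proof
      fix e assume "e \<in> {e \<in> E. v \<in> e}"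
      then have e: "e \<in> E" "v \<in> e" by auto
      obtain u where "e = {v, u}" by (rule simple_graph_edgeE[OF assms e])
      then show "e \<in> (\<lambda>u. {v, u}) ` neighbors E v" using e by (auto simp: neighbors_def)
    qed
  qed
  moreover have inj: "inj_on (\<lambda>u. {v, u}) (neighbors E v)"
    by (auto simp: inj_on_def doubleton_eq_iff)
  ultimately show "card (neighbors E v) = degree E v"
    unfolding degree_def by (metis card_image)
  have "neighbors E v \<subseteq> V" using simple_graph_edge(3)[OF assms] by (auto simp: neighbors_def)
  then show "finite (neighbors E v)" using assms finite_subset unfolding simple_graph_def by blast
qed

text \<open>Greedy colouring: neighbours, incident edges and \<open>B s\<close> exclude at most D of
  the D + 1 colours. Values at neighbours not yet coloured are avoided as well, at no cost in this
  count.\<close>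

lemma color_small_vertices:
  assumes G: "simple_graph V E" and "finite S"
    and "\<And>s. s \<in> S \<Longrightarrow> finite (B s) \<and> 2 * degree E s + card (B s) \<le> D" "S \<subseteq> V"
    and "partial_total_coloring V E S (D + 1) cv ce"
  shows "\<exists>cv'. total_coloring V E (D + 1) cv' ce \<and> (\<forall>v\<in>V - S. cv' v = cv v) \<and> (\<forall>v\<in>S. cv' v \<notin> B v)"
  using assms(2-)
proof (induction S arbitrary: cv rule: finite_induct)
  case empty
  then show ?case by (auto simp: partial_total_coloring_empty)
next
  case (insert s S)
  let ?A = "cv ` neighbors E s \<union> ce ` {e \<in> E. s \<in> e} \<union> B s"
  have fin: "finite (neighbors E s)" "finite {e \<in> E. s \<in> e}" "finite (B s)"
    using card_neighbors[OF G] simple_graph_finite[OF G] insert.prems(1) by auto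
  have "card ?A \<le> card (cv ` neighbors E s) + card (ce ` {e \<in> E. s \<in> e}) + card (B s)"
    by (meson card_Un_le add_le_mono1 le_trans)
  also have "\<dots> \<le> card (neighbors E s) + card {e \<in> E. s \<in> e} + card (B s)"
    using fin by (intro add_mono card_image_le) auto
  also have "\<dots> = 2 * degree E s + card (B s)" using card_neighbors[OF G] by (simp add: degree_def)
  also have "\<dots> \<le> D" using insert.prems(1) by simp
  finally have leA: "card ?A \<le> D" .
  have finA: "finite ?A" using fin by simp
  obtain x where x: "x \<in> {1..D + 1}" "x \<notin> ?A"
    using exists_color[OF finA leA] by (elim bexE) (rule that)
  then have xn: "x \<noteq> cv u" if "{s, u} \<in> E" for u using that by (auto simp: neighbors_def)
  have xn': "x \<noteq> cv u" if "{u, s} \<in> E" for u using that xn[of u] by (simp add: insert_commute)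
  have xe: "ce e \<noteq> x" if "e \<in> E" "s \<in> e" for e using that x by auto
  have ss: "{s, s} \<notin> E" using simple_graph_edge(1)[OF G, of s s] by blast
  have "partial_total_coloring V E S (D + 1) (cv(s := x)) ce"
    using insert.prems(3) x(1) xn xn' xe ss unfolding partial_total_coloring_def by auto
  from insert.IH[OF insert.prems(1)[OF insertI2] _ this] insert.prems(2)
  obtain cv' where cv': "total_coloring V E (D + 1) cv' ce" "\<forall>v\<in>V - S. cv' v = (cv(s := x)) v"
    "\<forall>v\<in>S. cv' v \<notin> B v"
    by blast
  moreover have "cv' s \<notin> B s" using cv'(2) x(2) insert.prems(2) insert.hyps(2) by auto
  ultimately show ?case using insert.hyps(2) by (intro exI[of _ cv']) auto
qed

text \<open>Planarity is replaced by the edge bound for subgraphs, and the maximum degree by an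
  upper bound \<open>D\<close>, so that all assumptions pass to subgraphs containing H. The sets
  \<open>B\<close> stay the same when edges are deleted.\<close>

locale precolored_graph =
  fixes V :: "'a set" and E :: "'a set set" and VH :: "'a set" and EH :: "'a set set"
    and cvH :: "'a \<Rightarrow> nat" and ceH :: "'a set \<Rightarrow> nat" and B :: "'a \<Rightarrow> nat set" and D :: nat
  assumes simple: "simple_graph V E"
    and sparse: "\<And>V' E'. V' \<subseteq> V \<Longrightarrow> E' \<subseteq> E \<Longrightarrow> \<forall>e\<in>E'. e \<subseteq> V' \<Longrightarrow> V' \<noteq> {} \<Longrightarrow>
      card E' + 3 \<le> 3 * card V'"
    and degree_le: "\<And>v. v \<in> V \<Longrightarrow> degree E v \<le> D"
    and D: "27 \<le> D"
    and H: "subgraph VH EH V E"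
    and matching: "distance3_matching V E VH EH"
    and colH: "total_coloring VH EH (D + 1) cvH ceH"
    and B_VH: "\<And>v. v \<in> VH \<Longrightarrow> B v = {}"
    and B_card: "\<And>v. v \<in> V \<Longrightarrow> finite (B v) \<and> card (B v) \<le> 2"
    and B_neighbor: "\<And>x v. x \<in> VH \<Longrightarrow> v \<in> V - VH \<Longrightarrow> {x, v} \<in> E \<Longrightarrow> cvH x \<in> B v"

lemma precolored_graph_subgraph:
  assumes "precolored_graph V E VH EH cvH ceH B D"
    and "V' \<subseteq> V" "E' \<subseteq> E" "\<forall>e\<in>E'. e \<subseteq> V'" "VH \<subseteq> V'" "EH \<subseteq> E'"
  shows "precolored_graph V' E' VH EH cvH ceH B D"
proof -
  interpret precolored_graph V E VH EH cvH ceH B D by fact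
  have fE: "finite E" using simple by (rule simple_graph_finite)
  have fV: "finite V'" using simple assms(2) finite_subset[of V' V] by (simp add: simple_graph_def)
  show ?thesis
  proof
    have "card e = 2" if "e \<in> E'" for e using simple assms(3) that by (auto simp: simple_graph_def)
    then show "simple_graph V' E'" using fV assms(4) by (simp add: simple_graph_def)
    show "card F + 3 \<le> 3 * card W" if "W \<subseteq> V'" "F \<subseteq> E'" "\<forall>e\<in>F. e \<subseteq> W" "W \<noteq> {}" for W F
      using sparse[of W F] that assms(2,3) by blast
    show "degree E' v \<le> D" if "v \<in> V'" for v
    proof -
      have "degree E' v \<le> degree E v"
        unfolding degree_def using fE assms(3) by (intro card_mono) auto
      then show ?thesis using degree_le[of v] that assms(2) by auto
    qed
    show "27 \<le> D" by (rule D)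
    show "subgraph VH EH V' E'"
      using H assms(5,6) by (simp add: subgraph_def)
    show "distance3_matching V' E' VH EH"
      using matching assms(2,3) unfolding distance3_matching_def by (meson subsetD)
    show "total_coloring VH EH (D + 1) cvH ceH" by (rule colH)
    show "cvH x \<in> B v" if "x \<in> VH" "v \<in> V' - VH" "{x, v} \<in> E'" for x v
      using that assms(2,3) by (intro B_neighbor) auto
  qed (use B_VH B_card assms(2) in auto)
qed

section \<open>Structure of a minimal counterexample\<close>

locale minimal_counterexample = precolored_graph +
  assumes not_extendable: "\<not> extendable VH EH cvH ceH B (D + 1) V E"
    and minimal: "\<And>V' E'. V' \<subseteq> V \<Longrightarrow> E' \<subseteq> E \<Longrightarrow> (V', E') \<noteq> (V, E) \<Longrightarrow> \<forall>e\<in>E'. e \<subseteq> V' \<Longrightarrow>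
      VH \<subseteq> V' \<Longrightarrow> EH \<subseteq> E' \<Longrightarrow> extendable VH EH cvH ceH B (D + 1) V' E'"
begin

abbreviation d :: "'a \<Rightarrow> nat" where "d \<equiv> degree E"

lemma finite_E: "finite E" and finite_V: "finite V"
  using simple simple_graph_finite unfolding simple_graph_def by auto

lemma no_partial_coloring:
  assumes "S \<subseteq> V - VH" "\<And>s. s \<in> S \<Longrightarrow> d s \<le> 5"
    and "\<And>v. v \<in> VH \<Longrightarrow> cv v = cvH v" "\<And>e. e \<in> EH \<Longrightarrow> ce e = ceH e"
    and "\<And>v. v \<in> V - S \<Longrightarrow> cv v \<notin> B v"
  shows "\<not> partial_total_coloring V E S (D + 1) cv ce"
proof
  assume c: "partial_total_coloring V E S (D + 1) cv ce"
  have SV: "S \<subseteq> V" "finite S" using assms(1) finite_V finite_subset by blast+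
  have small: "finite (B s) \<and> 2 * d s + card (B s) \<le> D" if "s \<in> S" for s
    using assms(2)[OF that] B_card[of s] SV(1) that D by fastforce
  obtain cv' where cv': "total_coloring V E (D + 1) cv' ce" "\<forall>v\<in>V - S. cv' v = cv v" "\<forall>v\<in>S. cv' v \<notin> B v"
    using color_small_vertices[OF simple SV(2) small SV(1) c] by blast
  moreover have "VH \<subseteq> V - S" using H assms(1) by (auto simp: subgraph_def)
  moreover have "\<forall>v\<in>V. cv' v \<notin> B v" using cv' assms(5) by (metis DiffI)
  ultimately have "extendable VH EH cvH ceH B (D + 1) V E"
    using assms(3,4) unfolding extendable_def by (intro exI[of _ cv'] exI[of _ ce]) auto
  then show False using not_extendable by simp
qed

text \<open>Once the graph without \<open>{u, v}\<close> is coloured, this edge has to avoid the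
  colours of d(u) - 1 + d(v) - 1 edges and of its ends outside \<open>S\<close>. A small uncoloured
  \<open>u\<close> can be put into \<open>S\<close> and coloured last, which saves one colour; a
  precoloured \<open>u\<close> cannot.\<close>

lemma recolor_edge:
  assumes uv: "{u, v} \<in> E" "{u, v} \<notin> EH"
    and S: "S = {u} \<and> u \<in> V - VH \<and> d u \<le> 5 \<or> S = {} \<and> u \<in> VH \<and> v \<in> V - VH"
  shows "D + card S < d u + d v"
proof (rule ccontr)
  assume le: "\<not> ?thesis"
  let ?E = "E - {{u, v}}"
  have uvV: "u \<noteq> v" "u \<in> V" "v \<in> V" using simple_graph_edge[OF simple uv(1)] by auto
  have "extendable VH EH cvH ceH B (D + 1) V ?E"
  proof (rule minimal)
    show "(V, ?E) \<noteq> (V, E)" using uv(1) by auto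
    show "\<forall>e\<in>?E. e \<subseteq> V" using simple by (simp add: simple_graph_def)
    show "VH \<subseteq> V" "EH \<subseteq> ?E" using H uv(2) by (auto simp: subgraph_def)
  qed auto
  then obtain cv ce where c: "total_coloring V ?E (D + 1) cv ce"
    and ext: "\<forall>v\<in>V. cv v \<notin> B v" "\<forall>v\<in>VH. cv v = cvH v" "\<forall>e\<in>EH. ce e = ceH e"
    unfolding extendable_def by blast
  let ?Au = "{e \<in> ?E. u \<in> e}" and ?Av = "{e \<in> ?E. v \<in> e}"
  have Au: "card ?Au = d u - 1" "card ?Av = d v - 1" "1 \<le> d u" "1 \<le> d v"
  proof -
    have "?Au = {e \<in> E. u \<in> e} - {{u, v}}" "?Av = {e \<in> E. v \<in> e} - {{u, v}}" by auto
    then show "card ?Au = d u - 1" "card ?Av = d v - 1"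
      using uv finite_E unfolding degree_def by (simp_all add: card_Diff_singleton)
    have "{e \<in> E. u \<in> e} \<noteq> {}" "{e \<in> E. v \<in> e} \<noteq> {}" using uv by auto
    then show "1 \<le> d u" "1 \<le> d v"
      using finite_E unfolding degree_def by (simp_all add: Suc_le_eq card_gt_0_iff)
  qed
  let ?A = "(ce ` ?Au \<union> ce ` ?Av) \<union> cv ` ({u, v} - S)"
  have fin: "finite ?A" using finite_E by simp
  have "card ({u, v} - S) + card S = 2" using S uvV(1) by auto
  moreover have "card ?A \<le> (card (ce ` ?Au) + card (ce ` ?Av)) + card (cv ` ({u, v} - S))"
    by (meson card_Un_le add_le_mono1 le_trans)
  moreover have "card (ce ` ?Au) \<le> card ?Au" "card (ce ` ?Av) \<le> card ?Av"
    "card (cv ` ({u, v} - S)) \<le> card ({u, v} - S)"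
    using finite_E by (auto intro!: card_image_le)
  ultimately have leA: "card ?A \<le> D" using Au le by linarith
  obtain x where x: "x \<in> {1..D + 1}" "x \<notin> ?A"
    using exists_color[OF fin leA] by (elim bexE) (rule that)
  define ce' where "ce' = ce({u, v} := x)"
  have xe: "ce e \<noteq> x" if "e \<in> ?E" "e \<inter> {u, v} \<noteq> {}" for e using that x(2) by auto
  have xv: "x \<noteq> cv w" if "w \<in> {u, v} - S" for w using that x(2) by auto
  let ?k = "D + 1"
  note c1 = total_coloringD[OF c]
  \<comment> \<open>The colouring is one of a graph without the edge \<open>{u, v}\<close>, so it is
    the forbidden set \<open>B v\<close> that keeps the two colours apart.\<close>
  have cuv: "cv u \<noteq> cv v" if "S = {}"
  proof -
    have "u \<in> VH" "v \<in> V - VH" using S that by auto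
    then have "cv u = cvH u" "cvH u \<in> B v" "cv v \<notin> B v" using ext B_neighbor uv(1) by auto
    then show ?thesis by metis
  qed
  have "partial_total_coloring V E S ?k cv ce'"
    unfolding partial_total_coloring_def
  proof (intro conjI ballI impI)
    show "cv w \<in> {1..?k}" if "w \<in> V - S" for w using c1(1) that by simp
    show "ce' e \<in> {1..?k}" if "e \<in> E" for e
      using that c1(2)[of e] x(1) by (cases "e = {u, v}") (simp_all add: ce'_def)
    show "cv a \<noteq> cv b" if "a \<in> V - S" "b \<in> V - S" "{a, b} \<in> E" for a b
    proof (cases "{a, b} = {u, v}")
      case True
      then have "u \<in> {a, b}" by simp
      then have "u \<notin> S" using that(1,2) by blast
      then have "S = {}" using S by blast
      then show ?thesis using cuv True by (auto simp: doubleton_eq_iff)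
    next
      case False
      then show ?thesis using that c1(3)[of a b] by simp
    qed
    show "ce' e \<noteq> ce' e'" if ee: "e \<in> E" "e' \<in> E" "e \<noteq> e' \<and> e \<inter> e' \<noteq> {}" for e e'
    proof -
      consider "e = {u, v}" "e' \<noteq> {u, v}" | "e \<noteq> {u, v}" "e' = {u, v}" | "e \<noteq> {u, v}" "e' \<noteq> {u, v}"
        using ee by blast
      then show ?thesis
      proof cases
        case 1
        then show ?thesis using xe[of e'] ee by (auto simp: ce'_def)
      next
        case 2
        then show ?thesis using xe[of e] ee by (auto simp: ce'_def)
      next
        case 3
        then show ?thesis using c1(4)[of e e'] ee by (simp add: ce'_def)
      qed
    qed
    show "ce' e \<noteq> cv w" if "e \<in> E" "w \<in> e - S" for e w
      using that xv[of w] c1(5)[of e w] by (cases "e = {u, v}") (simp_all add: ce'_def)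
  qed
  moreover have "ce' e = ceH e" if "e \<in> EH" for e
    using ext(3) that uv(2) by (auto simp: ce'_def)
  moreover have "S \<subseteq> V - VH" "\<And>s. s \<in> S \<Longrightarrow> d s \<le> 5" using S by auto
  ultimately show False using no_partial_coloring[of S cv ce'] ext by blast
qed

lemma small_edge:
  assumes "u \<in> V - VH" "d u \<le> 5" "{u, v} \<in> E"
  shows "D + 2 \<le> d u + d v"
proof -
  have "{u, v} \<notin> EH" using assms(1) H by (auto simp: subgraph_def)
  then show ?thesis using recolor_edge[of u v "{u}"] assms by simp
qed

lemma H_edge:
  assumes "x \<in> VH" "v \<in> V - VH" "{x, v} \<in> E"
  shows "D + 1 \<le> d x + d v"
proof -
  have "{x, v} \<notin> EH" using assms(2) H by (auto simp: subgraph_def)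
  then show ?thesis using recolor_edge[of x v "{}"] assms by simp
qed

text \<open>If every neighbour of \<open>U\<close> had at least \<open>i\<close> neighbours in
  \<open>U\<close>, the graph without \<open>U\<close> could be coloured by minimality, then the
  edges at \<open>U\<close> from lists, and finally the vertices of \<open>U\<close>
  greedily.\<close>

lemma alternating_coloring:
  assumes U: "U \<subseteq> V - VH" "\<And>u. u \<in> U \<Longrightarrow> d u \<le> i" and i: "i \<le> 5" and "U \<noteq> {}"
  shows "\<exists>w\<in>V. {u \<in> U. {u, w} \<in> E} \<noteq> {} \<and> card {u \<in> U. {u, w} \<in> E} < i"
proof (rule ccontr)
  assume "\<not> ?thesis"
  then have big: "i \<le> card {u \<in> U. {u, w} \<in> E}" if "u \<in> U" "{u, w} \<in> E" for u w
    using that simple_graph_edge(3)[OF simple that(2)] by fastforce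
  have deg: "24 \<le> d w" if "u \<in> U" "{u, w} \<in> E" for u w
  proof -
    have "d u \<le> 5" using U(2)[OF that(1)] i by simp
    then show ?thesis using small_edge[of u w] U(1) that D by auto
  qed
  \<comment> \<open>A neighbour of \<open>U\<close> has degree at least 24, hence is not itself in
    \<open>U\<close>. So the edges at \<open>U\<close> form a bipartite graph.\<close>
  have indep: "w \<notin> U" if "u \<in> U" "{u, w} \<in> E" for u w
    using deg[OF that] U(2)[of w] i by auto
  have finU: "finite U" using U(1) finite_V finite_subset by blast
  have EHU: "e \<inter> U = {}" if "e \<in> EH" for e
    using H U(1) that unfolding subgraph_def by blast
  let ?E = "{e \<in> E. e \<inter> U = {}}"
  have "extendable VH EH cvH ceH B (D + 1) (V - U) ?E"
  proof (rule minimal)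
    show "(V - U, ?E) \<noteq> (V, E)" using U(1) \<open>U \<noteq> {}\<close> by auto
    show "\<forall>e\<in>?E. e \<subseteq> V - U" using simple by (auto simp: simple_graph_def)
    show "VH \<subseteq> V - U" "EH \<subseteq> ?E" using H U(1) EHU by (auto simp: subgraph_def)
  qed auto
  then obtain cv ce where c: "total_coloring (V - U) ?E (D + 1) cv ce"
    and ext: "\<forall>v\<in>V - U. cv v \<notin> B v" "\<forall>v\<in>VH. cv v = cvH v" "\<forall>e\<in>EH. ce e = ceH e"
    unfolding extendable_def by blast
  note c1 = total_coloringD[OF c]
  define F where "F = {(u, w). u \<in> U \<and> {u, w} \<in> E}"
  have FV: "F \<subseteq> U \<times> V" using simple_graph_edge(3)[OF simple] by (auto simp: F_def)
  have finF: "finite F" using FV finU finite_V finite_subset by blast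
  \<comment> \<open>If \<open>w\<close> has k neighbours in \<open>U\<close>, at most D - k edges at
    \<open>w\<close> are coloured already; with the colour of \<open>w\<close> this leaves at least
    k of the D + 1 colours, and k is at least \<open>i\<close> by \<open>big\<close>.\<close>
  define L where "L uw = {1..D + 1} - insert (cv (snd uw)) (ce ` {e \<in> ?E. snd uw \<in> e})" for uw :: "'a \<times> 'a"
  have dF: "card {e' \<in> F. snd e' = w} = card {u \<in> U. {u, w} \<in> E}" for w
  proof -
    have "{e' \<in> F. snd e' = w} = (\<lambda>u. (u, w)) ` {u \<in> U. {u, w} \<in> E}" by (auto simp: F_def)
    then show ?thesis by (simp add: card_image inj_on_def)
  qed
  have "\<exists>c. proper_edge_coloring F c \<and> (\<forall>e\<in>F. c e \<in> L e)"
  proof (rule bipartite_list_edge_coloring[OF finF, of i])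
    fix u
    show "card {e \<in> F. fst e = u} \<le> i"
    proof (cases "u \<in> U")
      case True
      then have "{e \<in> F. fst e = u} = Pair u ` neighbors E u" by (auto simp: F_def neighbors_def)
      then have "card {e \<in> F. fst e = u} \<le> card (neighbors E u)"
        using card_image_le card_neighbors(1)[OF simple] by metis
      then show ?thesis using card_neighbors(2)[OF simple] U(2)[OF True] by simp
    next
      case False
      then have e: "{e \<in> F. fst e = u} = {}" by (auto simp: F_def)
      show ?thesis unfolding e by simp
    qed
  next
    fix uw assume "uw \<in> F"
    then obtain u w where uw: "uw = (u, w)" "u \<in> U" "{u, w} \<in> E" by (auto simp: F_def)
    let ?Uw = "{u \<in> U. {u, w} \<in> E}"
    have wU: "w \<notin> U" using indep[OF uw(2,3)] .
    have "(\<lambda>u. {u, w}) ` ?Uw \<union> {e \<in> ?E. w \<in> e} \<subseteq> {e \<in> E. w \<in> e}" by auto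
    then have "card ((\<lambda>u. {u, w}) ` ?Uw \<union> {e \<in> ?E. w \<in> e}) \<le> d w"
      unfolding degree_def using finite_E by (intro card_mono) auto
    also have "card ((\<lambda>u. {u, w}) ` ?Uw \<union> {e \<in> ?E. w \<in> e}) =
        card ((\<lambda>u. {u, w}) ` ?Uw) + card {e \<in> ?E. w \<in> e}"
      using finU finite_E by (intro card_Un_disjoint) auto
    also have "card ((\<lambda>u. {u, w}) ` ?Uw) = card ?Uw"
      by (rule card_image) (auto simp: inj_on_def doubleton_eq_iff)
    finally have Ew: "card ?Uw + card {e \<in> ?E. w \<in> e} \<le> d w" .
    have "card (insert (cv w) (ce ` {e \<in> ?E. w \<in> e})) \<le> 1 + card (ce ` {e \<in> ?E. w \<in> e})"
      by (rule order_trans[OF card_insert_le_m1]) auto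
    also have "card (ce ` {e \<in> ?E. w \<in> e}) \<le> card {e \<in> ?E. w \<in> e}"
      using finite_E by (intro card_image_le) auto
    finally have "card (insert (cv w) (ce ` {e \<in> ?E. w \<in> e})) \<le> 1 + card {e \<in> ?E. w \<in> e}" by simp
    moreover have "card {1..D + 1} - card (insert (cv w) (ce ` {e \<in> ?E. w \<in> e})) \<le> card (L uw)"
      unfolding L_def uw(1) snd_conv using finite_E by (intro diff_card_le_card_Diff) auto
    moreover have "d w \<le> D" using degree_le simple_graph_edge(3)[OF simple uw(3)] by simp
    ultimately have "card ?Uw \<le> card (L uw)" using Ew by simp
    moreover have "i \<le> card ?Uw" using big[OF uw(2,3)] .
    moreover have "card {e' \<in> F. snd e' = snd uw} = card ?Uw" using dF[of w] uw(1) by simp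
    ultimately show "finite (L uw) \<and> i \<le> card (L uw) \<and> card {e' \<in> F. snd e' = snd uw} \<le> card (L uw)"
      by (simp add: L_def)
  qed
  then obtain c where pc: "proper_edge_coloring F c" and cL: "\<And>e. e \<in> F \<Longrightarrow> c e \<in> L e" by blast
  \<comment> \<open>The description recovers the ordered pair behind an edge at \<open>U\<close>. It
    is unique because only one end of the edge lies in \<open>U\<close>.\<close>
  define ce' where "ce' e = (if e \<inter> U = {} then ce e else c (THE p. p \<in> F \<and> e = {fst p, snd p}))" for e
  have ce'_F: "ce' {u, w} = c (u, w)" if uw: "(u, w) \<in> F" for u w
  proof -
    have u: "u \<in> U" "{u, w} \<in> E" using uw by (auto simp: F_def)
    then have w: "w \<notin> U" using indep by blast
    have "(THE p. p \<in> F \<and> {u, w} = {fst p, snd p}) = (u, w)"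
      using uw u w by (intro the_equality) (auto simp: F_def doubleton_eq_iff)
    then show ?thesis using u by (simp add: ce'_def)
  qed
  have edge_cases: "e \<in> ?E \<and> ce' e = ce e \<or> (\<exists>u w. (u, w) \<in> F \<and> e = {u, w} \<and> u \<in> U \<and> w \<notin> U \<and> ce' e = c (u, w))"
    if "e \<in> E" for e
  proof (cases "e \<inter> U = {}")
    case True
    then show ?thesis using that by (simp add: ce'_def)
  next
    case False
    then obtain u where u: "u \<in> e" "u \<in> U" by blast
    obtain w where w: "e = {u, w}" by (rule simple_graph_edgeE[OF simple \<open>e \<in> E\<close> u(1)])
    then have "(u, w) \<in> F" "w \<notin> U" using that u indep[of u w] by (auto simp: F_def)
    then show ?thesis using ce'_F w u by blast
  qed
  have cF: "c (u, w) \<in> {1..D + 1}" "c (u, w) \<noteq> cv w" if "(u, w) \<in> F" for u w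
    using cL[OF that] by (auto simp: L_def)
  have cFe: "ce e \<noteq> c (u, w)" if "(u, w) \<in> F" "e \<in> ?E" "w \<in> e" for u w e
  proof -
    let ?C = "ce ` {e \<in> ?E. w \<in> e}"
    have mem: "ce e \<in> ?C" using that(2,3) by (intro imageI) simp
    have "c (u, w) \<notin> insert (cv w) ?C"
      using cL[OF that(1)] unfolding L_def snd_conv by (rule DiffE)
    then have "c (u, w) \<notin> ?C" by (rule contrapos_nn) (rule insertI2)
    then show ?thesis using mem by (intro notI) (simp only:)
  qed
  have "partial_total_coloring V E U (D + 1) cv ce'"
    unfolding partial_total_coloring_def
  proof (intro conjI ballI impI)
    show "cv w \<in> {1..D + 1}" if "w \<in> V - U" for w using c1(1)[OF that] .
    show "ce' e \<in> {1..D + 1}" if e: "e \<in> E" for e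
      using edge_cases[OF e]
    proof (elim disjE exE conjE)
      assume "e \<in> ?E" "ce' e = ce e"
      then show ?thesis using c1(2)[of e] by simp
    next
      fix u w assume "(u, w) \<in> F" "ce' e = c (u, w)"
      then show ?thesis using cF(1)[of u w] by simp
    qed
    show "cv a \<noteq> cv b" if "a \<in> V - U" "b \<in> V - U" "{a, b} \<in> E" for a b
      using c1(3)[of a b] that by auto
    show "ce' e \<noteq> cv w" if e: "e \<in> E" "w \<in> e - U" for e w
      using edge_cases[OF e(1)]
    proof (elim disjE exE conjE)
      assume "e \<in> ?E" "ce' e = ce e"
      then show ?thesis using c1(5)[of e w] e by simp
    next
      fix u w' assume "(u, w') \<in> F" "e = {u, w'}" "u \<in> U" "ce' e = c (u, w')"
      moreover from this have "w = w'" using e(2) by auto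
      ultimately show ?thesis using cF(2)[of u w'] by simp
    qed
    show "ce' e \<noteq> ce' e'" if ee: "e \<in> E" "e' \<in> E" "e \<noteq> e' \<and> e \<inter> e' \<noteq> {}" for e e'
    proof -
      have mixed: "ce' f \<noteq> ce' f'" if "f \<in> ?E" "ce' f = ce f" "(u, w) \<in> F" "f' = {u, w}" "u \<in> U"
        "ce' f' = c (u, w)" "f \<inter> f' \<noteq> {}" for f f' u w
      proof -
        have "w \<in> f" using that(1,4,5,7) by blast
        then show ?thesis using cFe[of u w f] that by simp
      qed
      show ?thesis
        using edge_cases[OF ee(1)]
      proof (elim disjE exE conjE)
        assume e: "e \<in> ?E" "ce' e = ce e"
        show ?thesis
          using edge_cases[OF ee(2)]
        proof (elim disjE exE conjE)
          assume "e' \<in> ?E" "ce' e' = ce e'"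
          then show ?thesis using c1(4)[of e e'] e ee by simp
        next
          fix u w assume "(u, w) \<in> F" "e' = {u, w}" "u \<in> U" "ce' e' = c (u, w)"
          then show ?thesis using mixed[OF e] ee(3) by blast
        qed
      next
        fix u w assume e: "(u, w) \<in> F" "e = {u, w}" "u \<in> U" "w \<notin> U" "ce' e = c (u, w)"
        show ?thesis
          using edge_cases[OF ee(2)]
        proof (elim disjE exE conjE)
          assume "e' \<in> ?E" "ce' e' = ce e'"
          then have "ce' e' \<noteq> ce' e" using mixed[of e' u w e] e ee(3) by blast
          then show ?thesis by simp
        next
          fix u' w' assume e': "(u', w') \<in> F" "e' = {u', w'}" "u' \<in> U" "w' \<notin> U" "ce' e' = c (u', w')"
          have "u = u' \<or> w = w'" "(u, w) \<noteq> (u', w')" using e e' ee(3) by auto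
          then have "c (u, w) \<noteq> c (u', w')"
            using pc e(1) e'(1) unfolding proper_edge_coloring_def by fastforce
          then show ?thesis using e e' by simp
        qed
      qed
    qed
  qed
  moreover have "ce' e = ceH e" if "e \<in> EH" for e
    using EHU[OF that] ext(3) that by (simp add: ce'_def)
  moreover have "d s \<le> 5" if "s \<in> U" for s using U(2)[OF that] i by simp
  ultimately show False using no_partial_coloring[of U cv ce'] U(1) ext by blast
qed

text \<open>A vertex \<open>w\<close> with at least one but fewer than \<open>i\<close> neighbours
  in \<open>U\<close> becomes the master of all of them, and the rest of \<open>U\<close> is treated
  recursively.\<close>

lemma masters:
  assumes i: "i \<le> 5" and "finite U" "U \<subseteq> V - VH" "\<And>u. u \<in> U \<Longrightarrow> d u \<le> i"
  shows "\<exists>m. (\<forall>u\<in>U. {u, m u} \<in> E) \<and> (\<forall>w. card {u \<in> U. m u = w} \<le> i - 1)"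
  using assms(2-)
proof (induction "card U" arbitrary: U rule: less_induct)
  case less
  show ?case
  proof (cases "U = {}")
    case True
    then show ?thesis by simp
  next
    case False
    then obtain w where w: "{u \<in> U. {u, w} \<in> E} \<noteq> {}" "card {u \<in> U. {u, w} \<in> E} < i"
      using alternating_coloring[OF less.prems(2,3) i] by blast
    let ?N = "{u \<in> U. {u, w} \<in> E}"
    have "card (U - ?N) < card U"
      using less.prems(1) w(1) by (intro psubset_card_mono) auto
    then have "\<exists>m. (\<forall>u\<in>U - ?N. {u, m u} \<in> E) \<and> (\<forall>w. card {u \<in> U - ?N. m u = w} \<le> i - 1)"
      using less.prems by (intro less.hyps) auto
    then obtain m where m: "\<And>u. u \<in> U - ?N \<Longrightarrow> {u, m u} \<in> E" "\<And>w. card {u \<in> U - ?N. m u = w} \<le> i - 1"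
      by blast
    define m' where "m' u = (if u \<in> ?N then w else m u)" for u
    have "{u, m' u} \<in> E" if "u \<in> U" for u using m(1)[of u] that by (auto simp: m'_def)
    moreover have "card {u \<in> U. m' u = x} \<le> i - 1" for x
    proof (cases "x = w")
      case True
      \<comment> \<open>\<open>w\<close> cannot be chosen again, since it has no neighbours in the
        smaller set.\<close>
      have "{u \<in> U. m' u = x} = ?N" using m(1) True by (auto simp: m'_def)
      then show ?thesis using w(2) by simp
    next
      case False
      then have "{u \<in> U. m' u = x} = {u \<in> U - ?N. m u = x}" by (auto simp: m'_def)
      then show ?thesis using m(2) by simp
    qed
    ultimately show ?thesis by blast
  qed
qed

end

section \<open>Discharging\<close>

lemma handshake:
  assumes "finite V" "finite E" "\<And>e. e \<in> E \<Longrightarrow> e \<subseteq> V \<and> card e = 2"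
  shows "(\<Sum>v\<in>V. degree E v) = 2 * card E"
proof -
  have "(\<Sum>v\<in>V. degree E v) = (\<Sum>v\<in>V. \<Sum>e\<in>E. if v \<in> e then 1 else 0)"
    using assms(2) by (intro sum.cong) (simp_all add: degree_def sum.If_cases Int_def)
  also have "\<dots> = (\<Sum>e\<in>E. \<Sum>v\<in>V. if v \<in> e then 1 else 0)" by (rule sum.swap)
  also have "\<dots> = (\<Sum>e\<in>E. 2)"
  proof (rule sum.cong[OF refl])
    fix e assume "e \<in> E"
    then have e: "e \<subseteq> V" "card e = 2" using assms(3) by auto
    have "{v \<in> V. v \<in> e} = e" using e(1) by blast
    then show "(\<Sum>v\<in>V. if v \<in> e then 1 else 0) = (2::nat)"
      using assms(1) e(2) by (simp add: sum.If_cases Int_def)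
  qed
  finally show ?thesis by simp
qed

context minimal_counterexample
begin

lemma VH_edge:
  assumes "v \<in> VH"
  obtains e where "e \<in> EH" "v \<in> e"
proof -
  have "card {e \<in> EH. v \<in> e} = 1"
    using matching assms unfolding distance3_matching_def is_matching_def degree_def by blast
  then have "{e \<in> EH. v \<in> e} \<noteq> {}" by (metis card.empty zero_neq_one)
  then show thesis using that by blast
qed

lemma EH_edge: "e \<in> EH \<Longrightarrow> e \<in> E \<and> e \<subseteq> VH"
  using H by (auto simp: subgraph_def)

lemma EH_distance:
  assumes "e1 \<in> EH" "e2 \<in> EH" "x \<in> e1" "y \<in> e2"
  shows "x = y \<or> {x, y} \<in> E \<Longrightarrow> e1 = e2" "{x, w} \<in> E \<Longrightarrow> {y, w} \<in> E \<Longrightarrow> e1 = e2"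
proof -
  have *: "x \<noteq> y \<and> {x, y} \<notin> E \<and> \<not> (\<exists>w\<in>V. {x, w} \<in> E \<and> {w, y} \<in> E)" if "e1 \<noteq> e2"
    using matching assms that unfolding distance3_matching_def by blast
  show "x = y \<or> {x, y} \<in> E \<Longrightarrow> e1 = e2" using * by blast
  show "e1 = e2" if w: "{x, w} \<in> E" "{y, w} \<in> E"
  proof (rule ccontr)
    assume "e1 \<noteq> e2"
    moreover have "w \<in> V" using simple_graph_edge(3)[OF simple w(1)] .
    ultimately show False using * w by (metis insert_commute)
  qed
qed

lemma degree_pos: "e \<in> E \<Longrightarrow> v \<in> e \<Longrightarrow> 1 \<le> d v"
  using finite_E unfolding degree_def by (auto simp: Suc_le_eq card_gt_0_iff)

lemma edge_unique:
  assumes "d v = 1" "e \<in> E" "f \<in> E" "v \<in> e" "v \<in> f"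
  shows "e = f"
  using assms unfolding degree_def by (metis (mono_tags, lifting) card_1_singletonE mem_Collect_eq singletonD)

definition small :: "nat \<Rightarrow> 'a set" where
  "small i = {u \<in> V - VH. d u \<le> i}"

definition isolated :: "'a set set" where
  "isolated = {e \<in> EH. \<forall>v\<in>e. d v = 1}"

text \<open>The instance i = 1 with a single vertex: some \<open>w\<close> would have a nonempty set
  of fewer than one neighbour in \<open>{u}\<close>.\<close>

lemma small_degree:
  assumes "u \<in> V - VH"
  shows "2 \<le> d u"
proof (rule ccontr)
  assume "\<not> ?thesis"
  then have "d u \<le> 1" by simp
  then show False using alternating_coloring[of "{u}" 1] assms by fastforce
qed

lemma isolated_edge:
  assumes "e \<in> E" "f \<in> isolated" "v \<in> e" "v \<in> f"
  shows "e = f"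
  using assms edge_unique[of v e f] EH_edge[of f] by (auto simp: isolated_def)

text \<open>Otherwise H would be all of G and its own colouring the extension. Needed because the
  edge bound requires a nonempty vertex set.\<close>

lemma not_all_isolated: "V \<noteq> \<Union>isolated"
proof
  assume V: "V = \<Union>isolated"
  have sub: "\<Union>isolated \<subseteq> VH" using EH_edge by (auto simp: isolated_def)
  have VH: "VH = V" using V sub H by (auto simp: subgraph_def)
  have "E \<subseteq> EH"
  proof
    fix e assume e: "e \<in> E"
    then have "card e = 2" "e \<subseteq> V" using simple by (auto simp: simple_graph_def)
    then obtain v where v: "v \<in> e" "v \<in> V" by (metis card.empty ex_in_conv subsetD zero_neq_numeral)
    then obtain f where f: "f \<in> isolated" "v \<in> f" using V by blast
    then show "e \<in> EH" using isolated_edge[OF e f(1) v(1) f(2)] by (simp add: isolated_def)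
  qed
  then have "EH = E" using H by (auto simp: subgraph_def)
  then have "extendable VH EH cvH ceH B (D + 1) V E"
    using colH VH B_VH unfolding extendable_def by (intro exI[of _ cvH] exI[of _ ceH]) auto
  then show False using not_extendable by simp
qed

text \<open>Isolated edges meet no other edge, so removing them with their ends preserves all other
  degrees, and the edge bound applies to what remains.\<close>

lemma sum_degree_bound: "(\<Sum>v\<in>V - \<Union>isolated. int (d v) - 6) < 0"
proof -
  let ?V = "V - \<Union>isolated" and ?E = "E - isolated"
  have e: "e \<subseteq> ?V \<and> card e = 2" if "e \<in> ?E" for e
    using that isolated_edge[of e] simple unfolding simple_graph_def by blast
  have "?V \<noteq> {}"
  proof -
    have "\<Union>isolated \<subseteq> V" using EH_edge H by (fastforce simp: isolated_def subgraph_def)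
    then show ?thesis using not_all_isolated by blast
  qed
  then have "card ?E + 3 \<le> 3 * card ?V"
    using e by (intro sparse) auto
  moreover have "(\<Sum>v\<in>?V. degree ?E v) = 2 * card ?E"
    by (rule handshake) (use finite_V finite_E e in auto)
  moreover have "(\<Sum>v\<in>?V. degree ?E v) = (\<Sum>v\<in>?V. d v)"
  proof (rule sum.cong[OF refl])
    fix v assume "v \<in> ?V"
    then have "{e \<in> ?E. v \<in> e} = {e \<in> E. v \<in> e}" by auto
    then show "degree ?E v = d v" by (simp add: degree_def)
  qed
  ultimately have "(\<Sum>v\<in>?V. d v) < 6 * card ?V" by linarith
  then have "int (\<Sum>v\<in>?V. d v) < int (6 * card ?V)" by (simp only: of_nat_less_iff)
  then show ?thesis by (simp add: sum_subtractf)
qed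

text \<open>Finds the vertex that pays for \<open>e\<close>. The bound 11 says that the charge of
  \<open>e\<close>, its degree sum minus 12, is negative. If \<open>v\<close> had degree at most 5,
  then \<open>small_edge\<close> would give \<open>z\<close> degree at least D - 3, which exceeds
  11.\<close>

lemma heavy_edge_neighbor:
  assumes e: "e \<in> EH - isolated" and s: "(\<Sum>z\<in>e. d z) \<le> 11"
  shows "\<exists>v. v \<in> V - VH \<and> 6 \<le> d v \<and> (\<exists>z\<in>e. {z, v} \<in> E)"
proof -
  have eE: "e \<in> E" "e \<subseteq> VH" using EH_edge e by auto
  have fin: "finite e" using simple eE finite_V finite_subset unfolding simple_graph_def by blast
  obtain z where z: "z \<in> e" "d z \<noteq> 1" using e by (auto simp: isolated_def)
  have dz: "d z \<le> 11" using member_le_sum[of z e d] fin z(1) s by simp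
  have "1 < d z" using z degree_pos[OF eE(1) z(1)] by simp
  then have "\<not> {f \<in> E. z \<in> f} \<subseteq> {e}"
    unfolding degree_def using card_mono[of "{e}" "{f \<in> E. z \<in> f}"] by auto
  then obtain f where f: "f \<in> E" "z \<in> f" "f \<noteq> e" by blast
  obtain v where v: "f = {z, v}" "v \<noteq> z" by (rule simple_graph_edgeE[OF simple f(1,2)])
  have vV: "v \<in> V" using simple_graph_edge(3)[OF simple] f(1) v by blast
  \<comment> \<open>A precoloured \<open>v\<close> lies on an edge of H adjacent to \<open>e\<close>
    or equal to it; by the distance condition it is \<open>e\<close>, and then \<open>f\<close>
    would be \<open>e\<close>.\<close>
  have vH: "v \<notin> VH"
  proof
    assume "v \<in> VH"
    then obtain e' where e': "e' \<in> EH" "v \<in> e'" by (rule VH_edge)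
    then have "e = e'" using EH_distance(1)[of e e' z v] e z f v by auto
    then have "f \<subseteq> e" using v e' z by auto
    moreover have "card f = 2" "card e = 2" using simple f eE by (auto simp: simple_graph_def)
    ultimately have "f = e" using fin by (intro card_subset_eq) auto
    then show False using f by simp
  qed
  have "6 \<le> d v"
  proof (rule ccontr)
    assume "\<not> ?thesis"
    then have "D + 2 \<le> d v + d z"
      using small_edge[of v z] f v vV vH by (auto simp: insert_commute)
    then show False using dz D \<open>\<not> 6 \<le> d v\<close> by linarith
  qed
  then show ?thesis using vV vH f v z by blast
qed

text \<open>Discharging with charge \<open>d v - 6\<close>: a vertex \<open>u\<close> of \<open>small 5\<close> receives 1 from each of its
  masters, one for every \<open>i\<close> between \<open>d u\<close> and 5, and an edge of the matching of negative
  total charge has its deficit paid by a single outside neighbour, which serves no other edge.\<close>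

lemma discharging: "0 \<le> (\<Sum>v\<in>V - \<Union>isolated. int (d v) - 6)"
proof -
  have "\<exists>m. \<forall>i. i \<le> 5 \<longrightarrow> (\<forall>u\<in>small i. {u, m i u} \<in> E) \<and> (\<forall>w. card {u \<in> small i. m i u = w} \<le> i - 1)"
    by (intro choice allI) (use masters[of _ "small _"] finite_V in \<open>auto simp: small_def\<close>)
  then obtain m where m: "\<And>i u. i \<le> 5 \<Longrightarrow> u \<in> small i \<Longrightarrow> {u, m i u} \<in> E"
    "\<And>i w. i \<le> 5 \<Longrightarrow> card {u \<in> small i. m i u = w} \<le> i - 1"
    by blast
  let ?V = "V - \<Union>isolated"
  let ?s = "\<lambda>e. \<Sum>z\<in>e. d z"
  define X where "X = {e \<in> EH - isolated. ?s e \<le> 11}"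
  have "\<exists>p. \<forall>e. e \<in> X \<longrightarrow> p e \<in> V - VH \<and> 6 \<le> d (p e) \<and> (\<exists>z\<in>e. {z, p e} \<in> E)"
    by (intro choice allI) (use heavy_edge_neighbor in \<open>auto simp: X_def\<close>)
  then obtain p where p: "\<And>e. e \<in> X \<Longrightarrow> p e \<in> V - VH \<and> 6 \<le> d (p e) \<and> (\<exists>z\<in>e. {z, p e} \<in> E)" by blast
  \<comment> \<open>The levels start at 2 because no small vertex has smaller degree. At level
    \<open>i\<close> a master serves at most i - 1 vertices, which gives 1 + 2 + 3 + 4 = 10 in
    total.\<close>
  define pay where "pay w = (\<Sum>i\<in>{2..5}. int (card {u \<in> small i. m i u = w}))" for w
  define hpay where "hpay v = (\<Sum>e\<in>{e \<in> X. p e = v}. 12 - int (?s e))" for v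
  define Bv where "Bv = {v \<in> V - VH. 6 \<le> d v}"
  have finEH: "finite EH" using finite_E finite_subset[of EH E] H by (simp add: subgraph_def)
  then have finX: "finite X" "finite (EH - isolated)" by (simp_all add: X_def)
  have fin: "finite Bv" "finite ?V" "\<And>i. finite (small i)" using finite_V by (auto simp: Bv_def small_def)
  have pay0: "0 \<le> pay w" for w by (simp add: pay_def sum_nonneg)
  have pay10: "pay w \<le> 10" for w
  proof -
    have "pay w \<le> (\<Sum>i\<in>{2..5}. int (i - 1))"
      unfolding pay_def
    proof (rule sum_mono)
      fix i :: nat assume "i \<in> {2..5}"
      then show "int (card {u \<in> small i. m i u = w}) \<le> int (i - 1)" using m(2)[of i w] by (simp only: of_nat_le_iff) simp
    qed
    also have "\<dots> = 10" by (simp add: numeral_eq_Suc sum.atLeast_Suc_atMost)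
    finally show ?thesis .
  qed
  \<comment> \<open>By \<open>small_edge\<close> a master has degree at least D + 2 - 5, so vertices
    of degree below 24 pay nothing to small vertices.\<close>
  have master_deg: "24 \<le> d (m i u)" "m i u \<in> ?V" if i: "i \<in> {2..5}" and u: "u \<in> small i" for i u
  proof -
    have e: "{u, m i u} \<in> E" using m(1) i u by simp
    have "u \<in> V - VH" "d u \<le> 5" using u i by (auto simp: small_def)
    then show deg: "24 \<le> d (m i u)" using small_edge[of u "m i u"] e D by linarith
    show "m i u \<in> ?V" using simple_graph_edge(3)[OF simple e] deg by (fastforce simp: isolated_def)
  qed
  have pay_deg: "pay w = 0" if "d w < 24" for w
  proof -
    have e: "{u \<in> small i. m i u = w} = {}" if "i \<in> {2..5}" for i
      using master_deg(1)[OF that] \<open>d w < 24\<close> by fastforce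
    show ?thesis unfolding pay_def
    proof (intro sum.neutral ballI)
      fix i :: nat assume "i \<in> {2..5}"
      then show "int (card {u \<in> small i. m i u = w}) = 0" unfolding e[OF \<open>i \<in> {2..5}\<close>] by simp
    qed
  qed
  \<comment> \<open>Double counting: \<open>u\<close> belongs to \<open>small i\<close> for the
    levels d(u), ..., 5 and so receives exactly its deficit 6 - d(u).\<close>
  have sum_pay: "(\<Sum>w\<in>?V. pay w) = (\<Sum>u\<in>small 5. 6 - int (d u))"
  proof -
    have "(\<Sum>w\<in>?V. pay w) = (\<Sum>i\<in>{2..5}. \<Sum>w\<in>?V. int (card {u \<in> small i. m i u = w}))"
      unfolding pay_def by (rule sum.swap)
    also have "\<dots> = (\<Sum>i\<in>{2..5}. int (card (small i)))"
    proof (rule sum.cong[OF refl])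
      fix i :: nat assume i: "i \<in> {2..5}"
      have "(\<Sum>w\<in>?V. \<Sum>u\<in>{u \<in> small i. m i u = w}. 1::int) = (\<Sum>u\<in>small i. 1)"
        by (rule sum.group) (use fin master_deg(2)[OF i] in auto)
      then show "(\<Sum>w\<in>?V. int (card {u \<in> small i. m i u = w})) = int (card (small i))" by simp
    qed
    also have "\<dots> = (\<Sum>i\<in>{2..5}. \<Sum>u\<in>small 5. if d u \<le> i then 1 else 0)"
    proof (rule sum.cong[OF refl])
      fix i :: nat assume "i \<in> {2..5}"
      then have "small i = {u \<in> small 5. d u \<le> i}" by (auto simp: small_def)
      then show "int (card (small i)) = (\<Sum>u\<in>small 5. if d u \<le> i then 1 else 0)"
        using fin(3)[of 5] by (simp add: sum.If_cases Int_def)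
    qed
    also have "\<dots> = (\<Sum>u\<in>small 5. \<Sum>i\<in>{2..5}. if d u \<le> i then 1 else 0)" by (rule sum.swap)
    also have "\<dots> = (\<Sum>u\<in>small 5. 6 - int (d u))"
    proof (rule sum.cong[OF refl])
      fix u assume "u \<in> small 5"
      then have "2 \<le> d u" "d u \<le> 5" using small_degree by (auto simp: small_def)
      moreover from this have "{i \<in> {2..5}. d u \<le> i} = {d u..5}" by auto
      ultimately show "(\<Sum>i\<in>{2..5}. if d u \<le> i then 1 else 0) = 6 - int (d u)"
        by (simp add: sum.If_cases Int_def)
    qed
    finally show ?thesis .
  qed
  have sum_hpay: "(\<Sum>v\<in>Bv. hpay v) = (\<Sum>e\<in>X. 12 - int (?s e))"
    unfolding hpay_def by (rule sum.group) (use fin finX p in \<open>auto simp: Bv_def\<close>)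
  \<comment> \<open>If \<open>v\<close> pays for an edge {z, y} of H, this costs at most 11 - d(z),
    besides at most 10 for small vertices. That the total is at most d(v) - 6 amounts to d(z) + d(v)
    >= 27, and \<open>H_edge\<close> gives at least D + 1. Otherwise \<open>v\<close> pays nothing
    or has degree at least 24.\<close>
  have heavy: "pay v + hpay v \<le> int (d v) - 6" if v: "v \<in> Bv" for v
  proof (cases "{e \<in> X. p e = v} = {}")
    case True
    then have "hpay v = 0" unfolding hpay_def True by simp
    then show ?thesis using pay10[of v] pay_deg[of v] v by (cases "d v < 24") (auto simp: Bv_def)
  next
    case False
    then obtain e where e: "e \<in> X" "p e = v" by blast
    obtain z where z: "z \<in> e" "{z, v} \<in> E" using p[OF e(1)] e(2) by blast
    have eH: "e \<in> EH" "e \<in> E" "e \<subseteq> VH" using e EH_edge by (auto simp: X_def)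
    have "f = e" if f: "f \<in> X" "p f = v" for f
    proof -
      obtain y where y: "y \<in> f" "{y, v} \<in> E" using p[OF f(1)] f(2) by blast
      have "f \<in> EH" using f by (simp add: X_def)
      then show ?thesis using EH_distance(2)[OF _ eH(1) y(1) z(1) y(2) z(2)] by simp
    qed
    then have "{e \<in> X. p e = v} = {e}" using e by blast
    then have h: "hpay v = 12 - int (?s e)" by (simp add: hpay_def)
    obtain y where y: "e = {z, y}" "y \<noteq> z" by (rule simple_graph_edgeE[OF simple eH(2) z(1)])
    have "1 \<le> d y" using degree_pos[OF eH(2)] y by simp
    then have "1 + d z \<le> ?s e" using y by simp
    moreover have "D + 1 \<le> d z + d v"
      using H_edge[of z v] z eH v by (auto simp: Bv_def)
    ultimately show ?thesis using h pay10[of v] D by linarith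
  qed
  \<comment> \<open>An end that pays has degree at least 24, so the edge has charge at least 12
    against a payment of 10; if both ends pay, it is at least 36 against 20. For \<open>e\<close> in
    \<open>X\<close> neither end pays, and the deficit comes from outside.\<close>
  have light: "(\<Sum>z\<in>e. pay z) \<le> int (?s e) - 12 + (if e \<in> X then 12 - int (?s e) else 0)"
    if e: "e \<in> EH - isolated" for e
  proof -
    have "card e = 2" using EH_edge e simple by (auto simp: simple_graph_def)
    then obtain x y where xy: "e = {x, y}" "x \<noteq> y" by (auto simp: card_2_iff)
    have P: "pay w \<le> 10 \<and> (d w < 24 \<longrightarrow> pay w = 0)" for w using pay10 pay_deg by blast
    show ?thesis
    proof (cases "e \<in> X")
      case True
      then have "d x < 24" "d y < 24" using xy by (auto simp: X_def)
      then show ?thesis using P[of x] P[of y] True xy by simp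
    next
      case False
      then have "12 \<le> d x + d y" using e xy by (auto simp: X_def)
      then show ?thesis using P[of x] P[of y] False xy by (cases "d x < 24"; cases "d y < 24") auto
    qed
  qed
  define VH' where "VH' = \<Union>(EH - isolated)"
  have disj: "e \<inter> f = {}" if "e \<in> EH" "f \<in> EH" "e \<noteq> f" for e f
    using EH_distance(1)[OF that(1,2)] that(3) by blast
  have VH': "VH' = VH - \<Union>isolated"
  proof
    show "VH' \<subseteq> VH - \<Union>isolated"
      using EH_edge disj unfolding VH'_def isolated_def by blast
    show "VH - \<Union>isolated \<subseteq> VH'"
    proof
      fix v assume v: "v \<in> VH - \<Union>isolated"
      then obtain e where "e \<in> EH" "v \<in> e" using VH_edge by blast
      then show "v \<in> VH'" using v by (auto simp: VH'_def)
    qed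
  qed
  have isoVH: "\<Union>isolated \<subseteq> VH" using EH_edge by (auto simp: isolated_def)
  have VHV: "VH \<subseteq> V" using H by (simp add: subgraph_def)
  have part: "?V = small 5 \<union> Bv \<union> VH'"
    unfolding VH' using isoVH VHV by (auto simp: small_def Bv_def)
  have finVH': "finite VH'" using part fin(2) by (metis finite_Un)
  have split: "(\<Sum>v\<in>?V. f v) = (\<Sum>v\<in>small 5. f v) + (\<Sum>v\<in>Bv. f v) + (\<Sum>v\<in>VH'. f v)" for f :: "'a \<Rightarrow> int"
  proof -
    have "(small 5 \<union> Bv) \<inter> VH' = {}" unfolding VH' by (auto simp: small_def Bv_def)
    moreover have "small 5 \<inter> Bv = {}" by (auto simp: small_def Bv_def)
    ultimately show ?thesis unfolding part using fin finVH' by (simp add: sum.union_disjoint)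
  qed
  have VH'_sum: "(\<Sum>v\<in>VH'. f v) = (\<Sum>e\<in>EH - isolated. \<Sum>z\<in>e. f z)" for f :: "'a \<Rightarrow> int"
    unfolding VH'_def
  proof (rule sum.Union_disjoint[unfolded comp_def])
    show "\<forall>e\<in>EH - isolated. finite e"
      using EH_edge H finite_V by (meson DiffD1 finite_subset subgraph_def)
    show "\<forall>e\<in>EH - isolated. \<forall>f\<in>EH - isolated. e \<noteq> f \<longrightarrow> e \<inter> f = {}" using disj by blast
  qed
  have A: "(\<Sum>v\<in>small 5. int (d v) - 6) = - (\<Sum>w\<in>?V. pay w)"
    unfolding sum_pay by (simp add: sum_negf[symmetric])
  have "(\<Sum>v\<in>small 5. pay v) = 0"
    using pay_deg by (intro sum.neutral) (auto simp: small_def)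
  then have P: "(\<Sum>w\<in>?V. pay w) = (\<Sum>v\<in>Bv. pay v) + (\<Sum>v\<in>VH'. pay v)" unfolding split by simp
  have Bsum: "(\<Sum>v\<in>Bv. pay v) + (\<Sum>e\<in>X. 12 - int (?s e)) \<le> (\<Sum>v\<in>Bv. int (d v) - 6)"
    unfolding sum_hpay[symmetric] sum.distrib[symmetric] by (intro sum_mono heavy)
  have Hsum: "(\<Sum>v\<in>VH'. pay v) \<le> (\<Sum>v\<in>VH'. int (d v) - 6) + (\<Sum>e\<in>X. 12 - int (?s e))"
  proof -
    have "(\<Sum>z\<in>e. int (d z) - 6) = int (?s e) - 12" if "e \<in> EH - isolated" for e
    proof -
      have "card e = 2" using EH_edge that simple by (auto simp: simple_graph_def)
      then show ?thesis by (simp add: sum_subtractf)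
    qed
    moreover have "(\<Sum>e\<in>X. 12 - int (?s e)) = (\<Sum>e\<in>EH - isolated. if e \<in> X then 12 - int (?s e) else 0)"
    proof -
      have "X = (EH - isolated) \<inter> {e. e \<in> X}" by (auto simp: X_def)
      then show ?thesis using finX(2) by (simp add: sum.If_cases)
    qed
    ultimately have eq: "(\<Sum>v\<in>VH'. int (d v) - 6) + (\<Sum>e\<in>X. 12 - int (?s e)) =
        (\<Sum>e\<in>EH - isolated. int (?s e) - 12 + (if e \<in> X then 12 - int (?s e) else 0))"
      unfolding VH'_sum sum.distrib by simp
    show ?thesis unfolding eq unfolding VH'_sum by (intro sum_mono light)
  qed
  \<comment> \<open>The deficits of the small vertices cancel the payments of all masters, and those
    of the edges in \<open>X\<close> occur once as expense and once as income.\<close>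
  show ?thesis using split[of "\<lambda>v. int (d v) - 6"] A P Bsum Hsum by linarith
qed

lemma contradiction: False
  using sum_degree_bound discharging by simp

end

section \<open>From minimal counterexamples to the theorem\<close>

theorem precolored_graph_extendable:
  assumes "precolored_graph V E VH EH cvH ceH B D"
  shows "extendable VH EH cvH ceH B (D + 1) V E"
  using assms
proof (induction "card V + card E" arbitrary: V E rule: less_induct)
  case less
  interpret precolored_graph V E VH EH cvH ceH B D by (rule less.prems)
  have fin: "finite V" "finite E" using simple simple_graph_finite by (auto simp: simple_graph_def)
  show ?case
  proof (rule ccontr)
    assume "\<not> ?thesis"
    then interpret minimal_counterexample V E VH EH cvH ceH B D
    proof unfold_locales
      fix V' E' assume s: "V' \<subseteq> V" "E' \<subseteq> E" "(V', E') \<noteq> (V, E)" "\<forall>e\<in>E'. e \<subseteq> V'" "VH \<subseteq> V'" "EH \<subseteq> E'"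
      have "card V' + card E' < card V + card E"
      proof (cases "V' = V")
        case True
        then have "card E' < card E" using s fin by (intro psubset_card_mono) auto
        then show ?thesis using True by simp
      next
        case False
        then have "card V' < card V" using s fin by (intro psubset_card_mono) auto
        moreover have "card E' \<le> card E" using s fin by (intro card_mono)
        ultimately show ?thesis by simp
      qed
      then show "extendable VH EH cvH ceH B (D + 1) V' E'"
        using precolored_graph_subgraph[OF less.prems] s by (intro less.hyps)
    qed
    show False by (rule contradiction)
  qed
qed

theorem theorem1p6:
  fixes V :: "'a set" and E :: "'a set set" and VH :: "'a set" and EH :: "'a set set"
    and cvH :: "'a \<Rightarrow> nat" and ceH :: "'a set \<Rightarrow> nat"
  assumes "simple_graph V E"
    and "planar V E"
    and "max_degree V E \<ge> 27"
    and "subgraph VH EH V E"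
    and "distance3_matching V E VH EH"
    and "total_coloring VH EH (max_degree V E + 1) cvH ceH"
  shows "\<exists>cv ce. total_coloring V E (max_degree V E + 1) cv ce \<and>
           (\<forall>v\<in>VH. cv v = cvH v) \<and> (\<forall>e\<in>EH. ce e = ceH e)"
proof -
  \<comment> \<open>The colours of precoloured neighbours. By the distance condition these
    neighbours are ends of one edge of H, hence at most two. Precoloured vertices have their colours
    fixed and get the empty set.\<close>
  define B where "B v = (if v \<in> VH then {} else cvH ` {x \<in> VH. {x, v} \<in> E})" for v
  have fV: "finite V" using assms(1) by (simp add: simple_graph_def)
  have B: "finite (B v) \<and> card (B v) \<le> 2" if v: "v \<in> V" for v
  proof (cases "v \<in> VH \<or> {x \<in> VH. {x, v} \<in> E} = {}")
    case True
    then have "B v = {}" by (auto simp: B_def)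
    then show ?thesis by simp
  next
    case False
    then obtain x where x: "x \<in> VH" "{x, v} \<in> E" by blast
    have cover: "\<exists>e\<in>EH. y \<in> e" if "y \<in> VH" for y
    proof -
      have "card {e \<in> EH. y \<in> e} = 1"
        using assms(5) that unfolding distance3_matching_def is_matching_def degree_def by blast
      then have "{e \<in> EH. y \<in> e} \<noteq> {}" by (metis card.empty zero_neq_one)
      then show ?thesis by blast
    qed
    obtain e where e: "e \<in> EH" "x \<in> e" using cover[OF x(1)] by blast
    have "{x \<in> VH. {x, v} \<in> E} \<subseteq> e"
    proof
      fix y assume y: "y \<in> {x \<in> VH. {x, v} \<in> E}"
      then obtain f where f: "f \<in> EH" "y \<in> f" using cover by blast
      have "{v, y} \<in> E" using y by (simp add: insert_commute)
      then have "f = e"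
        using assms(5) e f x v unfolding distance3_matching_def by blast
      then show "y \<in> e" using f by simp
    qed
    moreover have e2: "card e = 2" using assms(1,4) e(1) by (auto simp: simple_graph_def subgraph_def)
    moreover have "finite e" using e2 card.infinite by fastforce
    ultimately have "finite {x \<in> VH. {x, v} \<in> E}" "card {x \<in> VH. {x, v} \<in> E} \<le> 2"
      using finite_subset card_mono by metis+
    then show ?thesis
      using False card_image_le[of "{x \<in> VH. {x, v} \<in> E}" cvH] by (simp add: B_def)
  qed
  have "precolored_graph V E VH EH cvH ceH B (max_degree V E)"
  proof
    show "card E' + 3 \<le> 3 * card V'" if "V' \<subseteq> V" "E' \<subseteq> E" "\<forall>e\<in>E'. e \<subseteq> V'" "V' \<noteq> {}" for V' E'
      using planar_sparse[OF assms(1,2) that] .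
    show "degree E v \<le> max_degree V E" if "v \<in> V" for v
      unfolding max_degree_def using that fV by (intro Max_ge) auto
    show "B v = {}" if "v \<in> VH" for v using that by (simp add: B_def)
    show "finite (B v) \<and> card (B v) \<le> 2" if "v \<in> V" for v using B[OF that] .
    show "cvH x \<in> B v" if "x \<in> VH" "v \<in> V - VH" "{x, v} \<in> E" for x v
      using that by (auto simp: B_def)
  qed (use assms in auto)
  then show ?thesis using precolored_graph_extendable unfolding extendable_def by blast
qed

end
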